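(* Let $\Lambda=K\mathcal{Q}/I$ be a finite-dimensional algebra over a field $K$ as in the context, let $A\geqslant1$, and let $\tilde{\Lambda}=\tilde{\Lambda}_A$ be its stretched algebra, with Jacobson radicals $\mathfrak{r}$ of $\Lambda$ and $\tilde{\mathfrak{r}}$ of $\tilde{\Lambda}$. Let $(P^n,d^n)$ be a minimal projective resolution of $\Lambda/\mathfrak{r}$ as a right $\Lambda$-module given by sets $g^n$ ($n\ge0$). Define sets $\tilde{g}^n$ of uniform elements of $K\tilde{\mathcal{Q}}_A$ by: $\tilde{g}^0$ is the set of vertices of $\tilde{\mathcal{Q}}_A$, $\tilde{g}^1$ is the set of arrows of $\tilde{\mathcal{Q}}_A$, and for $n\geqslant2$, $\tilde{g}^n=\{\tilde{g}^n_i:=\theta^*(g^n_i)\mid g^n_i\in g^n\}$. Then the sets $\tilde{g}^n$ give a minimal projective resolution $(\tilde{P}^n,\tilde{d}^n)$ of $\tilde{\Lambda}/\tilde{\mathfrak{r}}$ as a right $\tilde{\Lambda}$-module; explicitly $\tilde{P}^n=\bigoplus_i\mathfrak{t}(\tilde{g}^n_i)\tilde{\Lambda}$, $\tilde{d}^0$ is the canonical surjection, $\tilde{d}^1$ sends the generator $\mathfrak{t}(\tilde\alpha)$ of the summand for an arrow $\tilde\alpha$ to $\tilde\alpha$ in the summand for $\mathfrak{o}(\tilde\alpha)$, $\tilde{d}^2$ sends the generator $\mathfrak{t}(\tilde{g}^2_i)$ to the element with entry $\mathfrak{t}(\tilde\alpha)\tilde\beta_{\tilde\alpha}$ in the summand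 for each arrow $\tilde\alpha$, where $\tilde{g}^2_i=\sum_{\tilde\alpha}\tilde\alpha\tilde\beta_{\tilde\alpha}$, and for $n\ge3$, if $g^n_i=\sum_jg^{n-1}_jr_j$ with $r_j\in K\mathcal{Q}$ (as in the given resolution), then $\tilde{d}^n$ sends $\mathfrak{t}(\tilde{g}^n_i)$ to the element with entry $\mathfrak{t}(\tilde{g}^{n-1}_j)\theta(r_j)$ in the summand for $\tilde{g}^{n-1}_j$.
   Context: Conventions: $\mathcal{Q}$ is a finite quiver; $\mathfrak{o}(\alpha)$, $\mathfrak{t}(\alpha)$ denote start and end of an arrow; paths are written left to right. An element $x\in K\mathcal{Q}$ is uniform if $x=vx=xv'$ for vertices $v,v'$, and then $\mathfrak{o}(x)=v$, $\mathfrak{t}(x)=v'$. $\Lambda=K\mathcal{Q}/I$ is finite-dimensional with $I$ an admissible ideal generated by a minimal set $g^2=\{g^2_1,\dots,g^2_m\}$ of uniform elements. Stretched algebra: for $A\geqslant1$, the quiver $\tilde{\mathcal{Q}}_A$ has all vertices of $\mathcal{Q}$ plus, for each arrow $\alpha$ of $\mathcal{Q}$, new vertices $w_1,\dots,w_{A-1}$; each arrow $\alpha$ is replaced by arrows $\alpha_1,\dots,\alpha_A$ with $\mathfrak{o}(\alpha_1)=\mathfrak{o}(\alpha)$, $\mathfrak{t}(\alpha_j)=\mathfrak{o}(\alpha_{j+1})=w_j$ ($1\le j\le A-1$), $\mathfrak{t}(\alpha_A)=\mathfrak{t}(\alpha)$, and the only arrows incident with $w_j$ are $\alpha_j,\alpha_{j+1}$.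 $\theta^*:K\mathcal{Q}\to K\tilde{\mathcal{Q}}_A$ is the algebra homomorphism fixing vertices and sending $\alpha\mapsto\alpha_1\cdots\alpha_A$; $\tilde{I}_A$ is the ideal generated by $\theta^*(g^2_1),\dots,\theta^*(g^2_m)$; $\tilde{\Lambda}_A=K\tilde{\mathcal{Q}}_A/\tilde{I}_A$; $\theta:\Lambda\to\tilde{\Lambda}_A$ is the algebra homomorphism induced by $\theta^*$. Resolution given by sets $g^n$ (Green–Solberg–Zacharia): $g^0$ is the set of vertices of $\mathcal{Q}$, $g^1$ the set of arrows, $g^2$ the minimal generating set of $I$, and for $n\ge3$, $g^n$ is a set of uniform elements of $K\mathcal{Q}$ such that each $x\in g^n$ can be written $x=\sum_ig^{n-1}_ir_i=\sum_jg^{n-2}_js_j$ with unique $r_i\in K\mathcal{Q}$, $s_j\in I$; the resolution has $P^n=\bigoplus_i\mathfrak{t}(g^n_i)\Lambda$ (one summand for each $g^n_i\in g^n$), $d^0:P^0\to\Lambda/\mathfrak{r}$ the canonical surjection, and for $n\ge1$ and $x\in g^n$ with $x=\sum_ig^{n-1}_ir_i$, $d^n$ sends the generator $\mathfrak{t}(x)$ of the summand for $x$ to the element with entry $\mathfrak{t}(g^{n-1}_i)r_i$ in the summand of $P^{n-1}$ corresponding to $g^{n-1}_i$. Such a minimal projective resolution of $\Lambda/\mathfrak{r}$ always exists. *)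

theory Defs
  imports Main
begin

record ('v, 'a) quiver =
  verts :: "'v set"
  arrs  :: "'a set"
  src   :: "'a \<Rightarrow> 'v"
  tgt   :: "'a \<Rightarrow> 'v"

definition wf_quiver :: "('v, 'a) quiver \<Rightarrow> bool" where
  "wf_quiver Q \<longleftrightarrow> (\<forall>\<alpha>\<in>arrs Q. src Q \<alpha> \<in> verts Q \<and> tgt Q \<alpha> \<in> verts Q)"

text \<open>A path is a pair (start vertex, list of arrows), written left to right;
  the trivial path at v is (v, []).\<close>
definition is_path :: "('v, 'a) quiver \<Rightarrow> 'v \<times> 'a list \<Rightarrow> bool" where
  "is_path Q p \<longleftrightarrow> fst p \<in> verts Q \<and> set (snd p) \<subseteq> arrs Q
     \<and> (snd p \<noteq> [] \<longrightarrow> src Q (hd (snd p)) = fst p)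
     \<and> (\<forall>i. Suc i < length (snd p) \<longrightarrow> tgt Q (snd p ! i) = src Q (snd p ! Suc i))"

definition path_end :: "('v, 'a) quiver \<Rightarrow> 'v \<times> 'a list \<Rightarrow> 'v" where
  "path_end Q p = (if snd p = [] then fst p else tgt Q (last (snd p)))"

definition path_concat :: "('v, 'a) quiver \<Rightarrow> 'v \<times> 'a list \<Rightarrow> 'v \<times> 'a list \<Rightarrow> ('v \<times> 'a list) option" where
  "path_concat Q p q = (if path_end Q p = fst q then Some (fst p, snd p @ snd q) else None)"

text \<open>Elements of the path algebra KQ: finitely supported K-valued functions on paths.\<close>
type_synonym ('v, 'a, 'k) pa = "'v \<times> 'a list \<Rightarrow> 'k"

definition supp :: "('v, 'a, 'k::zero) pa \<Rightarrow> ('v \<times> 'a list) set" where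
  "supp x = {p. x p \<noteq> 0}"

definition in_KQ :: "('v, 'a) quiver \<Rightarrow> ('v, 'a, 'k::zero) pa \<Rightarrow> bool" where
  "in_KQ Q x \<longleftrightarrow> finite (supp x) \<and> (\<forall>p\<in>supp x. is_path Q p)"

definition pzero :: "('v, 'a, 'k::zero) pa" where "pzero = (\<lambda>_. 0)"
definition padd :: "('v, 'a, 'k::plus) pa \<Rightarrow> ('v, 'a, 'k) pa \<Rightarrow> ('v, 'a, 'k) pa" where
  "padd x y = (\<lambda>p. x p + y p)"
definition psub :: "('v, 'a, 'k::minus) pa \<Rightarrow> ('v, 'a, 'k) pa \<Rightarrow> ('v, 'a, 'k) pa" where
  "psub x y = (\<lambda>p. x p - y p)"
definition psmult :: "'k::times \<Rightarrow> ('v, 'a, 'k) pa \<Rightarrow> ('v, 'a, 'k) pa" where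
  "psmult c x = (\<lambda>p. c * x p)"

definition pmult :: "('v, 'a) quiver \<Rightarrow> ('v, 'a, 'k::field) pa \<Rightarrow> ('v, 'a, 'k) pa \<Rightarrow> ('v, 'a, 'k) pa" where
  "pmult Q x y = (\<lambda>c. \<Sum>pq\<in>supp x \<times> supp y.
      if path_concat Q (fst pq) (snd pq) = Some c then x (fst pq) * y (snd pq) else 0)"

definition pth :: "'v \<times> 'a list \<Rightarrow> ('v, 'a, 'k::field) pa" where
  "pth p = (\<lambda>q. if q = p then 1 else 0)"
definition vtx :: "'v \<Rightarrow> ('v, 'a, 'k::field) pa" where
  "vtx v = pth (v, [])"
definition arr :: "('v, 'a) quiver \<Rightarrow> 'a \<Rightarrow> ('v, 'a, 'k::field) pa" where
  "arr Q \<alpha> = pth (src Q \<alpha>, [\<alpha>])"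

inductive_set ideal_gen :: "('v, 'a) quiver \<Rightarrow> ('v, 'a, 'k::field) pa set \<Rightarrow> ('v, 'a, 'k) pa set"
  for Q G where
  zero: "pzero \<in> ideal_gen Q G"
| add: "x \<in> ideal_gen Q G \<Longrightarrow> y \<in> ideal_gen Q G \<Longrightarrow> padd x y \<in> ideal_gen Q G"
| gen: "g \<in> G \<Longrightarrow> is_path Q p \<Longrightarrow> is_path Q q \<Longrightarrow>
        psmult c (pmult Q (pmult Q (pth p) g) (pth q)) \<in> ideal_gen Q G"

definition admissible :: "('v, 'a) quiver \<Rightarrow> ('v, 'a, 'k::field) pa set \<Rightarrow> bool" where
  "admissible Q I \<longleftrightarrow>
     (\<forall>x\<in>I. in_KQ Q x) \<and> pzero \<in> I \<and>
     (\<forall>x\<in>I. \<forall>y\<in>I. padd x y \<in> I) \<and>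
     (\<forall>x\<in>I. \<forall>c. psmult c x \<in> I) \<and>
     (\<forall>x\<in>I. \<forall>y. in_KQ Q y \<longrightarrow> pmult Q x y \<in> I \<and> pmult Q y x \<in> I) \<and>
     (\<exists>m\<ge>2. \<forall>p. is_path Q p \<longrightarrow> length (snd p) \<ge> m \<longrightarrow> pth p \<in> I) \<and>
     (\<forall>x\<in>I. \<forall>p\<in>supp x. length (snd p) \<ge> 2)"

definition uniform :: "('v, 'a) quiver \<Rightarrow> ('v, 'a, 'k::field) pa \<Rightarrow> bool" where
  "uniform Q x \<longleftrightarrow> in_KQ Q x \<and> (\<exists>v\<in>verts Q. x = pmult Q (vtx v) x)
      \<and> (\<exists>w\<in>verts Q. x = pmult Q x (vtx w))"

definition uterm :: "('v, 'a) quiver \<Rightarrow> ('v, 'a, 'k::field) pa \<Rightarrow> 'v" where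
  "uterm Q x = (SOME w. w \<in> verts Q \<and> x = pmult Q x (vtx w))"

definition min_gen_set :: "('v, 'a) quiver \<Rightarrow> ('v, 'a, 'k::field) pa set \<Rightarrow> ('v, 'a, 'k) pa set \<Rightarrow> bool" where
  "min_gen_set Q I G \<longleftrightarrow> finite G \<and> (\<forall>x\<in>G. uniform Q x \<and> x \<noteq> pzero)
     \<and> ideal_gen Q G = I \<and> (\<forall>x\<in>G. x \<notin> ideal_gen Q (G - {x}))"

section \<open>Resolutions given by sets g^n (Green--Solberg--Zacharia)\<close>

definition decomp_in :: "('v, 'a) quiver \<Rightarrow> ('v, 'a, 'k::field) pa set \<Rightarrow> ('v, 'a, 'k) pa set
    \<Rightarrow> ('v, 'a, 'k) pa \<Rightarrow> (('v, 'a, 'k) pa \<Rightarrow> ('v, 'a, 'k) pa) \<Rightarrow> bool" where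
  "decomp_in Q G S x r \<longleftrightarrow>
     (\<forall>z. z \<notin> G \<longrightarrow> r z = pzero) \<and>
     (\<forall>z\<in>G. in_KQ Q (r z) \<and> r z \<in> S \<and> r z = pmult Q (vtx (uterm Q z)) (r z)) \<and>
     x = (\<lambda>p. \<Sum>z\<in>G. pmult Q z (r z) p)"

definition coef :: "('v, 'a) quiver \<Rightarrow> (nat \<Rightarrow> ('v, 'a, 'k::field) pa set) \<Rightarrow> nat
    \<Rightarrow> ('v, 'a, 'k) pa \<Rightarrow> ('v, 'a, 'k) pa \<Rightarrow> ('v, 'a, 'k) pa" where
  "coef Q g n x z = (THE r. decomp_in Q (g (n - 1)) UNIV x r) z"

text \<open>Elements of P^n = \<Oplus>_{x\<in>g^n} t(x)\<Lambda>, represented by representatives in t(x)KQ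
  (componentwise modulo I).\<close>
definition inP :: "('v, 'a) quiver \<Rightarrow> (nat \<Rightarrow> ('v, 'a, 'k::field) pa set) \<Rightarrow> nat
    \<Rightarrow> (('v, 'a, 'k) pa \<Rightarrow> ('v, 'a, 'k) pa) \<Rightarrow> bool" where
  "inP Q g n f \<longleftrightarrow> (\<forall>x. x \<notin> g n \<longrightarrow> f x = pzero) \<and>
     (\<forall>x\<in>g n. in_KQ Q (f x) \<and> f x = pmult Q (vtx (uterm Q x)) (f x))"

definition dmap :: "('v, 'a) quiver \<Rightarrow> (nat \<Rightarrow> ('v, 'a, 'k::field) pa set) \<Rightarrow> nat
    \<Rightarrow> (('v, 'a, 'k) pa \<Rightarrow> ('v, 'a, 'k) pa) \<Rightarrow> (('v, 'a, 'k) pa \<Rightarrow> ('v, 'a, 'k) pa)" where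
  "dmap Q g n f = (\<lambda>z. if z \<in> g (n - 1)
      then (\<lambda>p. \<Sum>x\<in>g n. pmult Q (coef Q g n x z) (f x) p) else pzero)"

text \<open>d^0 : P^0 \<rightarrow> \<Lambda>/r \<cong> K^(vertices) (canonical surjection; r = J/I as I is admissible).\<close>
definition dzero :: "(('v, 'a, 'k::field) pa \<Rightarrow> ('v, 'a, 'k) pa) \<Rightarrow> 'v \<Rightarrow> 'k" where
  "dzero f = (\<lambda>v. f (vtx v) (v, []))"

definition gives_min_res :: "('v, 'a) quiver \<Rightarrow> ('v, 'a, 'k::field) pa set
    \<Rightarrow> (nat \<Rightarrow> ('v, 'a, 'k) pa set) \<Rightarrow> bool" where
  "gives_min_res Q I g \<longleftrightarrow>
     admissible Q I \<and>
     g 0 = vtx ` verts Q \<and> g 1 = arr Q ` arrs Q \<and>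
     min_gen_set Q I (g 2) \<and>
     (\<forall>n\<ge>3. finite (g n) \<and> (\<forall>x\<in>g n. uniform Q x \<and> x \<noteq> pzero
         \<and> (\<exists>!r. decomp_in Q (g (n - 1)) UNIV x r)
         \<and> (\<exists>!s. decomp_in Q (g (n - 2)) I x s))) \<and>
     \<comment> \<open>d^0 is surjective onto \<Lambda>/r\<close>
     (\<forall>c. \<exists>f. inP Q g 0 f \<and> (\<forall>v\<in>verts Q. dzero f v = c v)) \<and>
     \<comment> \<open>exactness at P^0\<close>
     (\<forall>f. inP Q g 0 f \<longrightarrow>
        ((\<forall>v\<in>verts Q. dzero f v = 0) \<longleftrightarrow>
         (\<exists>h. inP Q g 1 h \<and> (\<forall>x. psub (f x) (dmap Q g 1 h x) \<in> I)))) \<and>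
     \<comment> \<open>exactness at P^n, n \<ge> 1 (kernel and image computed modulo I)\<close>
     (\<forall>n\<ge>1. \<forall>f. inP Q g n f \<longrightarrow>
        ((\<forall>z. dmap Q g n f z \<in> I) \<longleftrightarrow>
         (\<exists>h. inP Q g (Suc n) h \<and> (\<forall>x. psub (f x) (dmap Q g (Suc n) h x) \<in> I)))) \<and>
     \<comment> \<open>minimality: Im d^n \<subseteq> P^(n-1) r for n \<ge> 1\<close>
     (\<forall>n\<ge>1. \<forall>x\<in>g n. \<forall>z\<in>g (n - 1). \<forall>v. coef Q g n x z (v, []) = 0)"

definition stretch :: "('v, 'a) quiver \<Rightarrow> nat \<Rightarrow> ('v + 'a \<times> nat, 'a \<times> nat) quiver" where
  "stretch Q A = \<lparr> verts = Inl ` verts Q \<union> {Inr (\<alpha>, j) | \<alpha> j. \<alpha> \<in> arrs Q \<and> 1 \<le> j \<and> j \<le> A - 1},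
                   arrs = {(\<alpha>, j) | \<alpha> j. \<alpha> \<in> arrs Q \<and> 1 \<le> j \<and> j \<le> A},
                   src = (\<lambda>(\<alpha>, j). if j = 1 then Inl (src Q \<alpha>) else Inr (\<alpha>, j - 1)),
                   tgt = (\<lambda>(\<alpha>, j). if j = A then Inl (tgt Q \<alpha>) else Inr (\<alpha>, j)) \<rparr>"

definition theta_path :: "nat \<Rightarrow> 'v \<times> 'a list \<Rightarrow> ('v + 'a \<times> nat) \<times> ('a \<times> nat) list" where
  "theta_path A p = (Inl (fst p), concat (map (\<lambda>\<alpha>. map (\<lambda>j. (\<alpha>, j)) [1..<Suc A]) (snd p)))"

definition thetastar :: "nat \<Rightarrow> ('v, 'a, 'k::field) pa \<Rightarrow> ('v + 'a \<times> nat, 'a \<times> nat, 'k) pa" where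
  "thetastar A x = (\<lambda>q. \<Sum>p\<in>supp x. if theta_path A p = q then x p else 0)"

definition gtilde :: "('v, 'a) quiver \<Rightarrow> nat \<Rightarrow> (nat \<Rightarrow> ('v, 'a, 'k::field) pa set)
    \<Rightarrow> nat \<Rightarrow> ('v + 'a \<times> nat, 'a \<times> nat, 'k) pa set" where
  "gtilde Q A g n = (if n = 0 then vtx ` verts (stretch Q A)
                     else if n = 1 then arr (stretch Q A) ` arrs (stretch Q A)
                     else thetastar A ` g n)"

end

theory Submission
  imports Defs "HOL-Library.Function_Algebras"
begin

text \<open>Every path of the stretched quiver that starts at an old vertex is uniquely \<open>\<theta>\<^sup>*(p) \<tau>\<close> with a path
  \<open>p\<close> of \<open>Q\<close> and a proper initial segment \<open>\<tau>\<close> of a stretched arrow. So the right module at an old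
  vertex splits, over the finitely many \<open>\<tau>\<close>, into copies of pieces of the right module over \<open>KQ\<close>;
  this splitting commutes with left multiplication by \<open>\<theta>\<^sup>*(x)\<close> and carries the stretched ideal to
  copies of \<open>I\<close>. Exactness in degrees \<open>n \<ge> 2\<close> and uniqueness of decompositions are therefore
  checked one \<open>\<tau>\<close> at a time. In degree 2 the differential ends in arrows \<open>\<alpha>\<^sub>1\<close> and carries an extra
  left factor \<open>\<alpha>\<^sub>2 \<cdots> \<alpha>\<^sub>A\<close>, which can be cancelled modulo the stretched ideal. Exactness in
  degrees 0 and 1 holds for every bound quiver and is not transferred.\<close>

text \<open>For n \<ge> 2 every element of \<open>gtilde Q A g n\<close> ends at an old vertex,
  because \<open>\<theta>\<^sup>*(x)\<close> ends where x does. So all summands of the modules in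
  these degrees are right modules at old vertices, and the splitting by tails reaches them
  completely. Right modules at new vertices occur only in degrees 0 and 1, whose generating sets are
  in general not images under \<open>\<theta>\<^sup>*\<close>; hence the separate treatment of these
  degrees. This mismatch is felt in two more places, where the arrows of the stretched quiver serve
  as generators on the left: the differential in degree 2, and the decompositions of elements of
  degree 3 with coefficients in the ideal. In both, the coefficient of an arrow is computed by left
  division, and \<open>\<alpha>\<^sub>1\<close> is only the first arrow of
  \<open>\<theta>\<^sup>*(\<alpha>)\<close>, which is where the extra factor comes from.\<close>

text \<open>As simp rules these would rewrite eta-expanded occurrences of the operations to pointwise form.\<close>
declare plus_fun_apply [simp del] zero_fun_apply [simp del] minus_apply [simp del]

lemma psmult_apply: "psmult c x p = c * x p"
  by (simp add: psmult_def)

lemmas pointwise = fun_eq_iff plus_fun_apply zero_fun_apply minus_apply psmult_apply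

lemma padd_eq_plus: "padd x y = x + y"
  by (simp add: padd_def pointwise)

lemma psub_eq_minus: "psub x y = x - y"
  by (simp add: psub_def pointwise)

lemma pzero_eq_zero: "pzero = 0"
  by (simp add: pzero_def pointwise)

lemma sum_fun_apply: "(\<Sum>a\<in>S. f a) p = (\<Sum>a\<in>S. f a p)"
  for f :: "'a \<Rightarrow> 'b \<Rightarrow> 'c::comm_monoid_add"
  by (induction S rule: infinite_finite_induct) (auto simp: pointwise)


lemma pth_apply: "pth p q = (if q = p then 1 else 0)"
  by (simp add: pth_def)

lemma pth_eq_iff [simp]: "(pth p :: ('v, 'a, 'k::field) pa) = pth q \<longleftrightarrow> p = q"
  by (metis pth_apply zero_neq_one)

lemma pth_nonzero [simp]: "(pth p :: ('v, 'a, 'k::field) pa) \<noteq> 0"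
  by (metis pth_apply zero_fun_apply zero_neq_one)

section \<open>Convolution\<close>

text \<open>A path has only finitely many factorizations into two pieces, so convolution makes sense
  for arbitrary functions on paths. Unlike the finite-support product \<open>pmult\<close> it is bilinear
  and associative without any side condition.\<close>
definition conv :: "('v, 'a) quiver \<Rightarrow> ('v, 'a, 'k::field) pa \<Rightarrow> ('v, 'a, 'k) pa \<Rightarrow> ('v, 'a, 'k) pa" where
  "conv Q x y = (\<lambda>c. \<Sum>i\<le>length (snd c). x (fst c, take i (snd c)) *
      y (path_end Q (fst c, take i (snd c)), drop i (snd c)))"

lemma conv_add_left: "conv Q (x + y) z = conv Q x z + conv Q y z"
  by (simp add: conv_def pointwise distrib_right sum.distrib)

lemma conv_add_right: "conv Q x (y + z) = conv Q x y + conv Q x z"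
  by (simp add: conv_def pointwise distrib_left sum.distrib)

lemma conv_diff_left: "conv Q (x - y) z = conv Q x z - conv Q y z"
  by (simp add: conv_def pointwise left_diff_distrib sum_subtractf)

lemma conv_diff_right: "conv Q x (y - z) = conv Q x y - conv Q x z"
  by (simp add: conv_def pointwise right_diff_distrib sum_subtractf)

lemma conv_zero_left [simp]: "conv Q 0 y = 0"
  by (simp add: conv_def pointwise)

lemma conv_zero_right [simp]: "conv Q x 0 = 0"
  by (simp add: conv_def pointwise)

lemma conv_psmult_left: "conv Q (psmult c x) y = psmult c (conv Q x y)"
  by (simp add: conv_def pointwise sum_distrib_left mult.assoc)

lemma conv_psmult_right: "conv Q x (psmult c y) = psmult c (conv Q x y)"
  by (simp add: conv_def pointwise sum_distrib_left mult_ac)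

lemma conv_sum_left: "conv Q (\<Sum>a\<in>S. f a) y = (\<Sum>a\<in>S. conv Q (f a) y)"
proof (induction S rule: infinite_finite_induct)
  case (insert b F)
  show ?case by (simp only: sum.insert[OF insert(1,2)] conv_add_left insert(3))
qed simp_all

lemma conv_sum_right: "conv Q x (\<Sum>a\<in>S. f a) = (\<Sum>a\<in>S. conv Q x (f a))"
proof (induction S rule: infinite_finite_induct)
  case (insert b F)
  show ?case by (simp only: sum.insert[OF insert(1,2)] conv_add_right insert(3))
qed simp_all

lemma path_end_append: "path_end Q (v, as @ bs) = path_end Q (path_end Q (v, as), bs)"
  by (simp add: path_end_def)

lemma path_end_Nil [simp]: "path_end Q (v, []) = v"
  by (simp add: path_end_def)

lemma path_end_Cons [simp]: "path_end Q (v, a # as) = path_end Q (tgt Q a, as)"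
  by (simp add: path_end_def)

lemma path_end_take_drop [simp]:
  "path_end Q (path_end Q (v, take i cs), drop i cs) = path_end Q (v, cs)"
  by (metis append_take_drop_id path_end_append)

text \<open>Both sides sum over pairs of cut points of one path. Bracketing to the left lists them
  as positions j \<le> i, bracketing to the right as j and the distance k = i - j to the second
  cut.\<close>

lemma conv_assoc: "conv Q (conv Q x y) z = conv Q x (conv Q y z)"
proof
  fix c :: "'a \<times> 'b list"
  obtain v cs where c: "c = (v, cs)" by fastforce
  define n where "n = length cs"
  define e where "e = (\<lambda>i. path_end Q (v, take i cs))"
  define f where "f = (\<lambda>(i, j). x (v, take j cs) * y (e j, drop j (take i cs)) * z (e i, drop i cs))"
  define h where "h = (\<lambda>(j, k). x (v, take j cs) * (y (e j, take k (drop j cs)) *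
      z (path_end Q (e j, take k (drop j cs)), drop k (drop j cs))))"
  have "conv Q (conv Q x y) z c = (\<Sum>i\<le>n. \<Sum>j\<le>i. f (i, j))"
    unfolding conv_def c f_def e_def n_def
    by (auto simp: sum_distrib_right min_def intro!: sum.cong)
  also have "\<dots> = (\<Sum>p\<in>Sigma {..n} (\<lambda>i. {..i}). f p)"
    by (simp add: sum.Sigma)
  also have "\<dots> = (\<Sum>p\<in>Sigma {..n} (\<lambda>j. {..n - j}). h p)"
  proof (rule sum.reindex_bij_witness[where i = "\<lambda>(j, k). (j + k, j)" and j = "\<lambda>(i, j). (j, i - j)"])
    fix p assume p: "p \<in> Sigma {..n} (\<lambda>i. {..i})"
    obtain i j where ij: "p = (i, j)" "i \<le> n" "j \<le> i" using p by auto
    have "path_end Q (path_end Q (v, take j cs), take (i - j) (drop j cs)) = path_end Q (v, take i cs)"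
      using ij by (metis le_add_diff_inverse path_end_append take_add)
    then show "h (case p of (i, j) \<Rightarrow> (j, i - j)) = f p"
      using ij by (simp add: h_def f_def e_def drop_take)
  qed auto
  also have "\<dots> = (\<Sum>j\<le>n. \<Sum>k\<le>n - j. h (j, k))"
    by (simp add: sum.Sigma)
  also have "\<dots> = conv Q x (conv Q y z) c"
    unfolding conv_def c h_def e_def n_def by (auto simp: sum_distrib_left intro!: sum.cong)
  finally show "conv Q (conv Q x y) z c = conv Q x (conv Q y z) c" .
qed

text \<open>\<open>pmult\<close> ranges over pairs of paths, \<open>conv\<close> over cut positions.
  A pair composing to \<open>c\<close> is the cut \<open>s i\<close> of \<open>c\<close> at the
  length i of its first member, and a cut with a member outside the supports contributes
  zero.\<close>

lemma pmult_eq_conv: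
  assumes "finite (supp x)" "finite (supp y)"
  shows "pmult Q x y = conv Q x y"
proof
  fix c :: "'a \<times> 'b list"
  obtain v cs where c: "c = (v, cs)" by fastforce
  define s where "s = (\<lambda>i. ((v, take i cs), (path_end Q (v, take i cs), drop i cs)))"
  have inj: "inj_on s {..length cs}"
    by (rule inj_onI) (auto simp: s_def dest: arg_cong[where f = length])
  have "conv Q x y c = (\<Sum>i\<le>length cs. x (fst (s i)) * y (snd (s i)))"
    by (simp add: conv_def c s_def)
  also have "\<dots> = (\<Sum>pq\<in>s ` {..length cs}. x (fst pq) * y (snd pq))"
    by (simp add: sum.reindex[OF inj])
  also have "\<dots> = (\<Sum>pq\<in>supp x \<times> supp y.
      if path_concat Q (fst pq) (snd pq) = Some c then x (fst pq) * y (snd pq) else 0)"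
  proof (rule sum.mono_neutral_cong)
    fix pq assume "pq \<in> supp x \<times> supp y - s ` {..length cs}"
    then have notin: "pq \<notin> s ` {..length cs}" by blast
    have "path_concat Q (fst pq) (snd pq) \<noteq> Some c"
    proof
      assume a: "path_concat Q (fst pq) (snd pq) = Some c"
      obtain p1 p2 q1 q2 where pq: "pq = ((p1, p2), (q1, q2))" by (metis prod.exhaust)
      from a have "pq = s (length p2)" "length p2 \<le> length cs"
        unfolding pq c s_def by (auto simp: path_concat_def split: if_splits)
      with notin show False by auto
    qed
    then show "(if path_concat Q (fst pq) (snd pq) = Some c then x (fst pq) * y (snd pq) else 0) = 0"
      by simp
  qed (use assms in \<open>auto simp: supp_def s_def path_concat_def c\<close>)
  finally show "pmult Q x y c = conv Q x y c"
    by (simp add: pmult_def)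
qed

lemma conv_vtx_left: "conv Q (vtx v) y = (\<lambda>p. if fst p = v then y p else 0)"
proof
  fix p :: "'a \<times> 'b list"
  obtain u cs where p: "p = (u, cs)" by fastforce
  have "conv Q (vtx v) y p = (\<Sum>i\<le>length cs. (if i = 0 then if u = v then y p else 0 else 0))"
    unfolding conv_def p by (rule sum.cong) (auto simp: vtx_def pth_apply)
  then show "conv Q (vtx v) y p = (if fst p = v then y p else 0)"
    by (simp add: p)
qed

lemma conv_vtx_right: "conv Q x (vtx v) = (\<lambda>p. if path_end Q p = v then x p else 0)"
proof
  fix p :: "'a \<times> 'b list"
  obtain u cs where p: "p = (u, cs)" by fastforce
  have "conv Q x (vtx v) p =
      (\<Sum>i\<le>length cs. (if i = length cs then if path_end Q p = v then x p else 0 else 0))"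
    unfolding conv_def p by (rule sum.cong) (auto simp: vtx_def pth_apply)
  then show "conv Q x (vtx v) p = (if path_end Q p = v then x p else 0)"
    by simp
qed

lemma supp_pth [simp]: "supp (pth p :: ('v, 'a, 'k::field) pa) = {p}"
  by (auto simp: supp_def pth_def)

lemma conv_pth_pth:
  "conv Q (pth p) (pth q) = (if path_end Q p = fst q then pth (fst p, snd p @ snd q) else 0)"
proof (subst pmult_eq_conv[symmetric])
  have *: "{p} \<times> {q} = {(p, q)}" by auto
  show "pmult Q (pth p) (pth q) = (if path_end Q p = fst q then pth (fst p, snd p @ snd q) else 0)"
    by (auto simp: pmult_def path_concat_def pointwise pth_apply *)
qed simp_all

lemma supp_conv_subset:
  "supp (conv Q x y) \<subseteq> (\<lambda>(p, q). (fst p, snd p @ snd q)) `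
      {(p, q). p \<in> supp x \<and> q \<in> supp y \<and> path_end Q p = fst q}"
proof
  fix c assume "c \<in> supp (conv Q x y)"
  then have "conv Q x y c \<noteq> 0" by (simp add: supp_def)
  then obtain i where i: "x (fst c, take i (snd c)) *
      y (path_end Q (fst c, take i (snd c)), drop i (snd c)) \<noteq> 0"
    unfolding conv_def by (rule sum.not_neutral_contains_not_neutral)
  show "c \<in> (\<lambda>(p, q). (fst p, snd p @ snd q)) `
      {(p, q). p \<in> supp x \<and> q \<in> supp y \<and> path_end Q p = fst q}"
    by (rule image_eqI[where x = "((fst c, take i (snd c)),
        (path_end Q (fst c, take i (snd c)), drop i (snd c)))"])
       (use i in \<open>auto simp: supp_def\<close>)
qed

lemma supp_convE:
  assumes "c \<in> supp (conv Q x y)"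
  obtains v as bs where "c = (v, as @ bs)" "(v, as) \<in> supp x" "(path_end Q (v, as), bs) \<in> supp y"
proof -
  from assms supp_conv_subset[of Q x y] obtain p q where
    "p \<in> supp x" "q \<in> supp y" "path_end Q p = fst q" "c = (fst p, snd p @ snd q)" by force
  then show thesis using that[of "fst p" "snd p" "snd q"] by simp
qed

section \<open>Elements of the path algebra\<close>

lemma in_KQ_finite: "in_KQ Q x \<Longrightarrow> finite (supp x)"
  by (simp add: in_KQ_def)

lemma in_KQ_pmult: "in_KQ Q x \<Longrightarrow> in_KQ Q y \<Longrightarrow> pmult Q x y = conv Q x y"
  by (simp add: pmult_eq_conv in_KQ_finite)

lemma in_KQ_zero [simp]: "in_KQ Q 0"
  by (simp add: in_KQ_def supp_def pointwise)

lemma in_KQ_add: "in_KQ Q x \<Longrightarrow> in_KQ Q y \<Longrightarrow> in_KQ Q (x + y)"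
  for x y :: "('v, 'a, 'k::field) pa"
proof -
  assume "in_KQ Q x" "in_KQ Q y"
  moreover have "supp (x + y) \<subseteq> supp x \<union> supp y" by (auto simp: supp_def pointwise)
  ultimately show ?thesis
    unfolding in_KQ_def by (meson UnE finite_Un finite_subset subsetD)
qed

lemma in_KQ_psmult: "in_KQ Q x \<Longrightarrow> in_KQ Q (psmult c x)" for x :: "('v, 'a, 'k::field) pa"
  by (auto simp: in_KQ_def supp_def psmult_apply)

lemma minus_eq_psmult: "x - y = x + psmult (- 1) y" for x :: "('v, 'a, 'k::field) pa"
  by (simp add: pointwise)

lemma in_KQ_diff: "in_KQ Q x \<Longrightarrow> in_KQ Q y \<Longrightarrow> in_KQ Q (x - y)"
  for x y :: "('v, 'a, 'k::field) pa"
  unfolding minus_eq_psmult by (intro in_KQ_add in_KQ_psmult)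

lemma in_KQ_sum: "(\<And>a. a \<in> S \<Longrightarrow> in_KQ Q (f a)) \<Longrightarrow> in_KQ Q (\<Sum>a\<in>S. f a)"
  for f :: "'b \<Rightarrow> ('v, 'a, 'k::field) pa"
  by (induction S rule: infinite_finite_induct) (auto intro: in_KQ_add)

lemma in_KQ_pth [simp]: "in_KQ Q (pth p :: ('v, 'a, 'k::field) pa) \<longleftrightarrow> is_path Q p"
  by (simp add: in_KQ_def)

lemma is_path_Nil [simp]: "is_path Q (v, []) \<longleftrightarrow> v \<in> verts Q"
  by (simp add: is_path_def)

lemma is_path_Cons:
  assumes "wf_quiver Q"
  shows "is_path Q (v, a # as) \<longleftrightarrow> a \<in> arrs Q \<and> src Q a = v \<and> is_path Q (tgt Q a, as)"
proof -
  have "(\<forall>i. Suc i < length (a # as) \<longrightarrow> tgt Q ((a # as) ! i) = src Q ((a # as) ! Suc i)) \<longleftrightarrow>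
     (as \<noteq> [] \<longrightarrow> src Q (hd as) = tgt Q a) \<and>
     (\<forall>i. Suc i < length as \<longrightarrow> tgt Q (as ! i) = src Q (as ! Suc i))"
    by (cases as) (auto simp: nth_Cons less_Suc_eq_0_disj split: nat.splits)
  then show ?thesis
    using assms by (auto simp: is_path_def wf_quiver_def)
qed

lemma is_path_append:
  assumes "wf_quiver Q"
  shows "is_path Q (v, as @ bs) \<longleftrightarrow> is_path Q (v, as) \<and> is_path Q (path_end Q (v, as), bs)"
proof (induction as arbitrary: v)
  case Nil
  then show ?case by (auto simp: is_path_def)
next
  case (Cons a as)
  then show ?case by (simp add: is_path_Cons[OF assms])
qed

lemma path_end_in_verts: "wf_quiver Q \<Longrightarrow> is_path Q (v, as) \<Longrightarrow> path_end Q (v, as) \<in> verts Q"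
  by (induction as arbitrary: v) (auto simp: is_path_Cons)

lemma in_KQ_conv:
  assumes "wf_quiver Q" "in_KQ Q x" "in_KQ Q y"
  shows "in_KQ Q (conv Q x y)"
proof -
  have "{(p, q). p \<in> supp x \<and> q \<in> supp y \<and> path_end Q p = fst q} \<subseteq> supp x \<times> supp y" by auto
  then have "finite {(p, q). p \<in> supp x \<and> q \<in> supp y \<and> path_end Q p = fst q}"
    by (rule finite_subset) (use assms in \<open>simp add: in_KQ_finite\<close>)
  then have "finite (supp (conv Q x y))"
    by (intro finite_subset[OF supp_conv_subset] finite_imageI)
  moreover have "is_path Q c" if "c \<in> supp (conv Q x y)" for c
    using that
    by (rule supp_convE) (use assms in \<open>auto simp: in_KQ_def is_path_append\<close>)
  ultimately show ?thesis by (simp add: in_KQ_def)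
qed

lemma in_KQ_vtx [simp]: "in_KQ Q (vtx v :: ('v, 'a, 'k::field) pa) \<longleftrightarrow> v \<in> verts Q"
  by (simp add: vtx_def)

lemma in_KQ_arr: "wf_quiver Q \<Longrightarrow> \<alpha> \<in> arrs Q \<Longrightarrow> in_KQ Q (arr Q \<alpha>)"
  by (simp add: arr_def is_path_Cons wf_quiver_def)

lemma pth_expansion:
  fixes x :: "('v, 'a, 'k::field) pa"
  assumes "finite (supp x)"
  shows "x = (\<Sum>p\<in>supp x. psmult (x p) (pth p))"
proof
  fix q
  have "(\<Sum>p\<in>supp x. psmult (x p) (pth p)) q = (\<Sum>p\<in>supp x. if q = p then x p else 0)"
    by (auto simp: sum_fun_apply psmult_apply pth_apply intro!: sum.cong)
  also have "\<dots> = x q" using assms by (simp add: supp_def)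
  finally show "x q = (\<Sum>p\<in>supp x. psmult (x p) (pth p)) q" by simp
qed

section \<open>Uniform elements\<close>

text \<open>Zero starts and ends at every vertex, so these predicates determine a vertex only for
  non-zero elements. Being conditions on the support, they make sense for functions that are not
  finitely supported.\<close>

definition starts_at :: "'v \<Rightarrow> ('v, 'a, 'k::field) pa \<Rightarrow> bool" where
  "starts_at v x \<longleftrightarrow> (\<forall>p. x p \<noteq> 0 \<longrightarrow> fst p = v)"

definition ends_at :: "('v, 'a) quiver \<Rightarrow> 'v \<Rightarrow> ('v, 'a, 'k::field) pa \<Rightarrow> bool" where
  "ends_at Q v x \<longleftrightarrow> (\<forall>p. x p \<noteq> 0 \<longrightarrow> path_end Q p = v)"

lemma starts_at_iff: "starts_at v x \<longleftrightarrow> x = conv Q (vtx v) x"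
  by (auto simp: starts_at_def conv_vtx_left fun_eq_iff)

lemma ends_at_iff: "ends_at Q v x \<longleftrightarrow> x = conv Q x (vtx v)"
  by (auto simp: ends_at_def conv_vtx_right fun_eq_iff)

lemma starts_at_zero [simp]: "starts_at v 0"
  by (simp add: starts_at_def pointwise)

lemma starts_at_add: "starts_at v x \<Longrightarrow> starts_at v y \<Longrightarrow> starts_at v (x + y)"
  unfolding starts_at_def plus_fun_apply by (metis add_0)

lemma starts_at_diff: "starts_at v x \<Longrightarrow> starts_at v y \<Longrightarrow> starts_at v (x - y)"
  unfolding starts_at_def minus_apply by (metis diff_0_right)

lemma starts_at_psmult: "starts_at v x \<Longrightarrow> starts_at v (psmult c x)"
  by (auto simp: starts_at_def psmult_apply)

lemma starts_at_sum: "(\<And>a. a \<in> S \<Longrightarrow> starts_at v (f a)) \<Longrightarrow> starts_at v (\<Sum>a\<in>S. f a)"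
  by (induction S rule: infinite_finite_induct) (auto intro: starts_at_add)

lemma starts_at_pth [simp]: "starts_at v (pth p) \<longleftrightarrow> fst p = v"
  by (simp add: starts_at_def pth_apply del: split_paired_All)

lemma starts_at_conv: "starts_at v x \<Longrightarrow> starts_at v (conv Q x y)"
  by (metis starts_at_iff conv_assoc)

lemma conv_eq_zero_mismatch:
  assumes "ends_at Q v x" "starts_at w y" "v \<noteq> w"
  shows "conv Q x y = 0"
proof -
  have "conv Q x y = conv Q x (conv Q (conv Q (vtx v) (vtx w)) y)"
    using assms(1,2) by (metis conv_assoc ends_at_iff starts_at_iff)
  also have "conv Q (vtx v) (vtx w) = (0 :: ('a, 'b, 'c) pa)"
    using assms(3) by (simp add: vtx_def conv_pth_pth)
  finally show ?thesis by simp
qed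

lemma pmult_vtx_left: "in_KQ Q x \<Longrightarrow> pmult Q (vtx v) x = conv Q (vtx v) x"
  by (simp add: pmult_eq_conv in_KQ_finite vtx_def)

lemma pmult_vtx_right: "in_KQ Q x \<Longrightarrow> pmult Q x (vtx v) = conv Q x (vtx v)"
  by (simp add: pmult_eq_conv in_KQ_finite vtx_def)

lemma uniform_iff:
  "uniform Q x \<longleftrightarrow> in_KQ Q x \<and> (\<exists>v\<in>verts Q. starts_at v x) \<and> (\<exists>w\<in>verts Q. ends_at Q w x)"
  unfolding uniform_def starts_at_iff[of _ _ Q] ends_at_iff
  by (auto simp: pmult_vtx_left pmult_vtx_right)

lemma uterm_props:
  assumes "uniform Q x"
  shows "uterm Q x \<in> verts Q" "ends_at Q (uterm Q x) x"
proof -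
  have "in_KQ Q x" using assms by (simp add: uniform_def)
  then have "uterm Q x = (SOME w. w \<in> verts Q \<and> ends_at Q w x)"
    by (simp add: uterm_def ends_at_iff pmult_vtx_right)
  moreover have "\<exists>w. w \<in> verts Q \<and> ends_at Q w x"
    using assms by (auto simp: uniform_iff)
  ultimately show "uterm Q x \<in> verts Q" "ends_at Q (uterm Q x) x"
    using someI_ex[of "\<lambda>w. w \<in> verts Q \<and> ends_at Q w x"] by auto
qed

lemma ends_at_unique: "ends_at Q v x \<Longrightarrow> ends_at Q w x \<Longrightarrow> x \<noteq> 0 \<Longrightarrow> v = w"
  by (auto simp: ends_at_def pointwise)

lemma uterm_eqI:
  "uniform Q x \<Longrightarrow> x \<noteq> 0 \<Longrightarrow> ends_at Q w x \<Longrightarrow> uterm Q x = w"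
  by (metis uterm_props(2) ends_at_unique)

lemma ends_at_pth [simp]: "ends_at Q v (pth p) \<longleftrightarrow> path_end Q p = v"
  by (simp add: ends_at_def pth_apply del: split_paired_All)

lemma uniform_pth: "wf_quiver Q \<Longrightarrow> is_path Q p \<Longrightarrow> uniform Q (pth p)"
  by (cases p) (auto simp: uniform_iff path_end_in_verts is_path_def)

lemma uterm_pth: "wf_quiver Q \<Longrightarrow> is_path Q p \<Longrightarrow> uterm Q (pth p :: ('v, 'a, 'k::field) pa) = path_end Q p"
  by (rule uterm_eqI) (auto simp: uniform_pth)

lemma vtx_eq_iff [simp]: "(vtx v :: ('v, 'a, 'k::field) pa) = vtx w \<longleftrightarrow> v = w"
  by (simp add: vtx_def)

lemma arr_eq_iff [simp]: "(arr Q \<alpha> :: ('v, 'a, 'k::field) pa) = arr Q \<beta> \<longleftrightarrow> \<alpha> = \<beta>"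
  by (auto simp: arr_def)

lemma uterm_vtx: "wf_quiver Q \<Longrightarrow> v \<in> verts Q \<Longrightarrow> uterm Q (vtx v :: ('v, 'a, 'k::field) pa) = v"
  by (simp add: vtx_def uterm_pth)

lemma is_path_arr: "wf_quiver Q \<Longrightarrow> \<alpha> \<in> arrs Q \<Longrightarrow> is_path Q (src Q \<alpha>, [\<alpha>])"
  by (simp add: is_path_Cons wf_quiver_def)

lemma uterm_arr: "wf_quiver Q \<Longrightarrow> \<alpha> \<in> arrs Q \<Longrightarrow> uterm Q (arr Q \<alpha> :: ('v, 'a, 'k::field) pa) = tgt Q \<alpha>"
  by (simp add: arr_def uterm_pth is_path_arr)

lemma starts_at_vtx [simp]: "starts_at v (vtx w) \<longleftrightarrow> w = v"
  by (simp add: vtx_def)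

section \<open>Two-sided ideals\<close>

definition two_sided :: "('v, 'a) quiver \<Rightarrow> ('v, 'a, 'k::field) pa set \<Rightarrow> bool" where
  "two_sided Q I \<longleftrightarrow> (\<forall>x\<in>I. in_KQ Q x) \<and> 0 \<in> I \<and> (\<forall>x\<in>I. \<forall>y\<in>I. x + y \<in> I) \<and>
     (\<forall>x\<in>I. \<forall>c. psmult c x \<in> I) \<and>
     (\<forall>x\<in>I. \<forall>y. in_KQ Q y \<longrightarrow> conv Q x y \<in> I \<and> conv Q y x \<in> I)"

lemma two_sidedD:
  assumes "two_sided Q I"
  shows "x \<in> I \<Longrightarrow> in_KQ Q x" "0 \<in> I" "x \<in> I \<Longrightarrow> y \<in> I \<Longrightarrow> x + y \<in> I"
    "x \<in> I \<Longrightarrow> psmult c x \<in> I" "x \<in> I \<Longrightarrow> in_KQ Q z \<Longrightarrow> conv Q x z \<in> I"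
    "x \<in> I \<Longrightarrow> in_KQ Q z \<Longrightarrow> conv Q z x \<in> I"
  using assms by (auto simp: two_sided_def)

lemma two_sided_diff: "two_sided Q I \<Longrightarrow> x \<in> I \<Longrightarrow> y \<in> I \<Longrightarrow> x - y \<in> I"
  unfolding minus_eq_psmult by (simp add: two_sidedD)

lemma two_sided_sum: "two_sided Q I \<Longrightarrow> (\<And>a. a \<in> S \<Longrightarrow> f a \<in> I) \<Longrightarrow> (\<Sum>a\<in>S. f a) \<in> I"
  by (induction S rule: infinite_finite_induct) (auto intro: two_sidedD)

lemma admissible_iff:
  "admissible Q I \<longleftrightarrow> two_sided Q I \<and>
     (\<exists>m\<ge>2. \<forall>p. is_path Q p \<longrightarrow> length (snd p) \<ge> m \<longrightarrow> pth p \<in> I) \<and>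
     (\<forall>x\<in>I. \<forall>p\<in>supp x. length (snd p) \<ge> 2)"
proof -
  have "(\<forall>x\<in>I. \<forall>y. in_KQ Q y \<longrightarrow> pmult Q x y \<in> I \<and> pmult Q y x \<in> I) \<longleftrightarrow>
      (\<forall>x\<in>I. \<forall>y. in_KQ Q y \<longrightarrow> conv Q x y \<in> I \<and> conv Q y x \<in> I)"
    if "\<forall>x\<in>I. in_KQ Q x"
    using that by (auto simp: in_KQ_pmult)
  then show ?thesis
    by (auto simp: admissible_def two_sided_def padd_eq_plus pzero_eq_zero)
qed

lemma ideal_gen_gen:
  assumes "g \<in> G" "in_KQ Q g" "wf_quiver Q" "is_path Q p" "is_path Q q"
  shows "psmult c (conv Q (conv Q (pth p) g) (pth q)) \<in> ideal_gen Q G"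
  using ideal_gen.gen[OF assms(1,4,5), of c] assms by (simp add: in_KQ_pmult in_KQ_conv)

lemma ideal_gen_conv_induct [consumes 3, case_names zero add gen]:
  assumes "x \<in> ideal_gen Q G" "\<forall>g\<in>G. in_KQ Q g" "wf_quiver Q"
    and "P 0" "\<And>x y. x \<in> ideal_gen Q G \<Longrightarrow> y \<in> ideal_gen Q G \<Longrightarrow> P x \<Longrightarrow> P y \<Longrightarrow> P (x + y)"
    and "\<And>g p q c. g \<in> G \<Longrightarrow> is_path Q p \<Longrightarrow> is_path Q q \<Longrightarrow>
      P (psmult c (conv Q (conv Q (pth p) g) (pth q)))"
  shows "P x"
  using assms(1)
proof induction
  case zero
  then show ?case using assms(4) by (simp add: pzero_eq_zero)
next
  case (add x y)
  then show ?case using assms(5) by (simp add: padd_eq_plus)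
next
  case (gen g p q c)
  then show ?case using assms(6)[of g p q c] assms(2,3) by (simp add: in_KQ_pmult in_KQ_conv)
qed

lemma psmult_psmult: "psmult c (psmult d x) = psmult (c * d) (x :: ('v, 'a, 'k::field) pa)"
  by (simp add: pointwise mult.assoc)

lemma psmult_add: "psmult c (x + y) = psmult c x + psmult c (y :: ('v, 'a, 'k::field) pa)"
  by (simp add: pointwise distrib_left)

lemma psmult_zero [simp]: "psmult c (0 :: ('v, 'a, 'k::field) pa) = 0"
  by (simp add: pointwise)

lemma ideal_gen_zero [simp]: "0 \<in> ideal_gen Q G"
  using ideal_gen.zero by (metis pzero_eq_zero)

lemma ideal_gen_add: "x \<in> ideal_gen Q G \<Longrightarrow> y \<in> ideal_gen Q G \<Longrightarrow> x + y \<in> ideal_gen Q G"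
  using ideal_gen.add by (metis padd_eq_plus)

lemma ideal_gen_sum: "(\<And>a. a \<in> S \<Longrightarrow> f a \<in> ideal_gen Q G) \<Longrightarrow> (\<Sum>a\<in>S. f a) \<in> ideal_gen Q G"
  by (induction S rule: infinite_finite_induct) (auto intro: ideal_gen_add)

text \<open>The generating clause of \<open>ideal_gen\<close> sandwiches a generator only between
  single paths. A further factor is expanded into paths, and a product of two paths is a path or
  zero, so the sandwiched shape survives multiplication on either side.\<close>

lemma two_sided_ideal_gen:
  assumes "\<forall>g\<in>G. in_KQ Q g" and wf: "wf_quiver Q"
  shows "two_sided Q (ideal_gen Q G)"
proof -
  have KQ: "in_KQ Q x" if "x \<in> ideal_gen Q G" for x
    using that assms
    by (induction rule: ideal_gen_conv_induct) (simp_all add: in_KQ_add in_KQ_psmult in_KQ_conv assms)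
  have smult: "psmult c x \<in> ideal_gen Q G" if "x \<in> ideal_gen Q G" for x c
    using that assms
  proof (induction rule: ideal_gen_conv_induct)
    case (gen g p q d)
    then show ?case using assms by (simp add: psmult_psmult ideal_gen_gen)
  qed (auto simp: psmult_add intro: ideal_gen_add)
  have right_pth: "conv Q x (pth r) \<in> ideal_gen Q G"
    if "x \<in> ideal_gen Q G" "is_path Q r" for x r
    using that(1) assms
  proof (induction rule: ideal_gen_conv_induct)
    case (gen g p q c)
    have "path_end Q q = fst r \<Longrightarrow> is_path Q (fst q, snd q @ snd r)"
      using gen that(2) wf by (cases q; cases r) (auto simp: is_path_append)
    then show ?case using gen assms
      by (simp add: conv_psmult_left conv_assoc[of Q _ "pth q"] conv_pth_pth ideal_gen_gen)
  qed (auto simp: conv_add_left intro: ideal_gen_add)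
  have left_pth: "conv Q (pth r) x \<in> ideal_gen Q G"
    if "x \<in> ideal_gen Q G" "is_path Q r" for x r
    using that(1) assms
  proof (induction rule: ideal_gen_conv_induct)
    case (gen g p q c)
    have "path_end Q r = fst p \<Longrightarrow> is_path Q (fst r, snd r @ snd p)"
      using gen that(2) wf by (cases p; cases r) (auto simp: is_path_append)
    moreover have "conv Q (pth r) (psmult c (conv Q (conv Q (pth p) g) (pth q))) =
        psmult c (conv Q (conv Q (conv Q (pth r) (pth p)) g) (pth q))"
      by (simp add: conv_psmult_right conv_assoc)
    ultimately show ?case using gen assms
      by (simp add: conv_pth_pth ideal_gen_gen)
  qed (auto simp: conv_add_right intro: ideal_gen_add)
  have "conv Q x y \<in> ideal_gen Q G \<and> conv Q y x \<in> ideal_gen Q G"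
    if "x \<in> ideal_gen Q G" "in_KQ Q y" for x y
  proof -
    have y: "y = (\<Sum>p\<in>supp y. psmult (y p) (pth p))"
      using that(2) by (simp add: in_KQ_finite flip: pth_expansion)
    have "conv Q x (psmult (y p) (pth p)) \<in> ideal_gen Q G"
      "conv Q (psmult (y p) (pth p)) x \<in> ideal_gen Q G" if "p \<in> supp y" for p
      using that \<open>x \<in> _\<close> \<open>in_KQ Q y\<close>
      by (auto simp: conv_psmult_left conv_psmult_right in_KQ_def intro!: smult right_pth left_pth)
    then show ?thesis
      by (subst (1 2) y) (auto simp: conv_sum_left conv_sum_right intro!: ideal_gen_sum)
  qed
  with KQ smult show ?thesis
    by (auto simp: two_sided_def ideal_gen_add)
qed

text \<open>A generator enters the ideal only in sandwiched form; uniformity provides the two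
  trivial paths for which the sandwich is \<open>g\<close> itself.\<close>

lemma ideal_gen_superset:
  assumes "g \<in> G" "uniform Q g" "wf_quiver Q"
  shows "g \<in> ideal_gen Q G"
proof -
  obtain v w where "v \<in> verts Q" "w \<in> verts Q" "g = conv Q (vtx v) g" "g = conv Q g (vtx w)"
    using assms(2) unfolding uniform_iff starts_at_iff[of _ _ Q] ends_at_iff by blast
  moreover have "in_KQ Q g" using assms(2) by (simp add: uniform_iff)
  ultimately have "psmult 1 g \<in> ideal_gen Q G"
    using ideal_gen_gen[OF assms(1) _ assms(3), of "(v, [])" "(w, [])" 1]
    by (simp flip: vtx_def)
  then show ?thesis by (simp add: psmult_def)
qed

section \<open>Left division by an arrow\<close>

text \<open>The coefficient of \<alpha> when \<open>y\<close> is sorted by first arrows. The value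
  of \<open>y\<close> that is used does not depend on \<open>fst p\<close>, so the test on
  \<open>fst p\<close> is what makes the result start at the end of \<alpha>.\<close>

definition ldiv :: "('v, 'a) quiver \<Rightarrow> 'a \<Rightarrow> ('v, 'a, 'k::field) pa \<Rightarrow> ('v, 'a, 'k) pa" where
  "ldiv Q \<alpha> y = (\<lambda>p. if fst p = tgt Q \<alpha> then y (src Q \<alpha>, \<alpha> # snd p) else 0)"

lemma ldiv_zero [simp]: "ldiv Q \<alpha> 0 = 0"
  by (simp add: ldiv_def pointwise)

lemma ldiv_add: "ldiv Q \<alpha> (x + y) = ldiv Q \<alpha> x + ldiv Q \<alpha> y"
  by (simp add: ldiv_def pointwise)

lemma ldiv_psmult: "ldiv Q \<alpha> (psmult c x) = psmult c (ldiv Q \<alpha> x)"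
  by (simp add: ldiv_def pointwise)

lemma ldiv_sum: "ldiv Q \<alpha> (\<Sum>a\<in>S. f a) = (\<Sum>a\<in>S. ldiv Q \<alpha> (f a))"
  by (induction S rule: infinite_finite_induct) (auto simp: ldiv_add)

lemma starts_at_ldiv [simp]: "starts_at (tgt Q \<alpha>) (ldiv Q \<alpha> y)"
  by (simp add: starts_at_def ldiv_def)

lemma in_KQ_ldiv:
  assumes "wf_quiver Q" "in_KQ Q y"
  shows "in_KQ Q (ldiv Q \<alpha> y)"
proof -
  have "supp (ldiv Q \<alpha> y) \<subseteq> (\<lambda>p. (tgt Q \<alpha>, tl (snd p))) ` supp y"
    by (force simp: supp_def ldiv_def split: if_splits)
  then have "finite (supp (ldiv Q \<alpha> y))"
    by (rule finite_subset) (intro finite_imageI in_KQ_finite[OF assms(2)])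
  moreover have "is_path Q p" if "p \<in> supp (ldiv Q \<alpha> y)" for p
  proof -
    from that have "is_path Q (src Q \<alpha>, \<alpha> # snd p)" "fst p = tgt Q \<alpha>"
      using assms(2) by (auto simp: supp_def ldiv_def in_KQ_def split: if_splits)
    then show ?thesis by (cases p) (simp add: is_path_Cons assms(1))
  qed
  ultimately show ?thesis by (simp add: in_KQ_def)
qed

text \<open>A cut before the first arrow would use a trivial path of \<open>x\<close>, whose
  coefficient is zero. So in every contributing cut \<alpha> belongs to the left factor.\<close>

lemma ldiv_conv:
  assumes "\<And>v. x (v, []) = 0"
  shows "ldiv Q \<alpha> (conv Q x y) = conv Q (ldiv Q \<alpha> x) y"
  by (simp add: fun_eq_iff ldiv_def conv_def sum.atMost_Suc_shift assms del: sum.atMost_Suc)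

lemma ldiv_pth_Cons:
  "ldiv Q \<alpha> (pth (u, a # as)) = (if a = \<alpha> \<and> u = src Q \<alpha> then pth (tgt Q \<alpha>, as) else 0)"
  by (auto simp: ldiv_def pth_apply pointwise)

lemma ldiv_conv_pth_Cons:
  "ldiv Q \<alpha> (conv Q (pth (u, a # as)) y) =
     (if a = \<alpha> \<and> u = src Q \<alpha> then conv Q (pth (tgt Q \<alpha>, as)) y else 0)"
  by (subst ldiv_conv) (auto simp: pth_apply ldiv_pth_Cons)

lemma ldiv_conv_arr:
  assumes "starts_at (tgt Q \<alpha>) f"
  shows "ldiv Q \<beta> (conv Q (arr Q \<alpha>) f) = (if \<beta> = \<alpha> then f else 0)"
  using assms
  by (auto simp: arr_def ldiv_conv_pth_Cons starts_at_iff[of _ _ Q] vtx_def)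

lemma conv_arr: "conv Q (arr Q \<alpha>) f (v, cs) =
    (case cs of [] \<Rightarrow> 0 | b # bs \<Rightarrow> if v = src Q \<alpha> \<and> b = \<alpha> then f (tgt Q \<alpha>, bs) else 0)"
proof (cases cs)
  case (Cons b bs)
  have "conv Q (arr Q \<alpha>) f (v, cs) = (\<Sum>i\<le>length bs.
      if i = 0 then if v = src Q \<alpha> \<and> b = \<alpha> then f (tgt Q \<alpha>, bs) else 0 else 0)"
    unfolding conv_def Cons snd_conv list.size add_0_right add_Suc_right sum.atMost_Suc_shift
    by (simp add: arr_def pth_apply del: sum.delta sum.delta', intro conjI impI sum.cong; cases "bs = []"; auto)
  then show ?thesis by (simp add: Cons)
qed (simp add: conv_def arr_def pth_apply)

text \<open>The paths of positive length span the direct sum of the right ideals generated by the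
  arrows; the left quotients are the coordinates.\<close>

lemma arrow_expansion:
  assumes "wf_quiver Q" "finite (arrs Q)" "in_KQ Q y" "\<And>v. y (v, []) = 0"
  shows "y = (\<Sum>\<alpha>\<in>arrs Q. conv Q (arr Q \<alpha>) (ldiv Q \<alpha> y))"
proof
  fix p :: "'a \<times> 'b list"
  obtain v cs where p: "p = (v, cs)" by fastforce
  show "y p = (\<Sum>\<alpha>\<in>arrs Q. conv Q (arr Q \<alpha>) (ldiv Q \<alpha> y)) p"
  proof (cases cs)
    case (Cons b bs)
    have "(\<Sum>\<alpha>\<in>arrs Q. conv Q (arr Q \<alpha>) (ldiv Q \<alpha> y)) p =
        (\<Sum>\<alpha>\<in>arrs Q. if b = \<alpha> then if v = src Q b then y p else 0 else 0)"
      unfolding sum_fun_apply p by (rule sum.cong) (auto simp: conv_arr Cons ldiv_def)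
    also have "\<dots> = (if b \<in> arrs Q \<and> v = src Q b then y p else 0)"
      using assms(2) by simp
    also have "\<dots> = y p"
    proof (cases "y p = 0")
      case False
      then have "is_path Q (v, b # bs)"
        using assms(3) unfolding p Cons by (simp add: in_KQ_def supp_def)
      then show ?thesis by (simp add: is_path_Cons assms(1))
    qed simp
    finally show ?thesis by simp
  qed (simp add: p assms sum_fun_apply conv_arr)
qed

section \<open>Decompositions\<close>

lemma decomp_in_iff:
  assumes "\<forall>z\<in>G. in_KQ Q z"
  shows "decomp_in Q G S x r \<longleftrightarrow> (\<forall>z. z \<notin> G \<longrightarrow> r z = 0) \<and>
     (\<forall>z\<in>G. in_KQ Q (r z) \<and> r z \<in> S \<and> starts_at (uterm Q z) (r z)) \<and>
     x = (\<Sum>z\<in>G. conv Q z (r z))"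
proof -
  have "(\<lambda>p. \<Sum>z\<in>G. pmult Q z (r z) p) = (\<Sum>z\<in>G. conv Q z (r z))"
    if "\<forall>z\<in>G. in_KQ Q (r z)"
    using that assms by (auto simp: fun_eq_iff sum_fun_apply in_KQ_pmult intro!: sum.cong)
  then show ?thesis
    unfolding decomp_in_def starts_at_iff[of _ _ Q]
    by (auto simp: pzero_eq_zero pmult_vtx_left)
qed

lemma inP_iff:
  "inP Q g n f \<longleftrightarrow> (\<forall>x. x \<notin> g n \<longrightarrow> f x = 0) \<and>
     (\<forall>x\<in>g n. in_KQ Q (f x) \<and> starts_at (uterm Q x) (f x))"
  unfolding inP_def starts_at_iff[of _ _ Q] by (auto simp: pzero_eq_zero pmult_vtx_left)

lemma coef_eq: "(\<And>r'. decomp_in Q (g (n - 1)) UNIV x r' \<longleftrightarrow> r' = r) \<Longrightarrow> coef Q g n x = r"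
  by (rule ext) (simp add: coef_def)

lemma decomp_in_coef:
  assumes "\<exists>!r. decomp_in Q (g (n - 1)) UNIV x r"
  shows "decomp_in Q (g (n - 1)) UNIV x (coef Q g n x)"
proof -
  have "coef Q g n x = (THE r. decomp_in Q (g (n - 1)) UNIV x r)"
    by (rule ext) (simp add: coef_def)
  with theI'[OF assms] show ?thesis by simp
qed

lemma dmap_eq_conv:
  assumes "\<And>x. x \<in> g n \<Longrightarrow> in_KQ Q (coef Q g n x z)" "inP Q g n f" "z \<in> g (n - 1)"
  shows "dmap Q g n f z = (\<Sum>x\<in>g n. conv Q (coef Q g n x z) (f x))"
  using assms by (auto simp: dmap_def inP_iff fun_eq_iff sum_fun_apply in_KQ_pmult intro!: sum.cong)

lemma dmap_outside: "z \<notin> g (n - 1) \<Longrightarrow> dmap Q g n f z = 0"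
  by (simp add: dmap_def pzero_eq_zero)

text \<open>Left multiplication by an arrow is injective on elements starting at its end, and
  products with different arrows share no path. So the coefficients are forced to be the left
  quotients, and the only question is whether these lie in \<open>S\<close>. With
  \<open>S = UNIV\<close> this yields the coefficients in degree 2, with an ideal the decompositions
  of elements of degree 3.\<close>

lemma decomp_in_arrows_iff:
  assumes wf: "wf_quiver Q" and fin: "finite (arrs Q)" and x: "in_KQ Q x" "\<And>v. x (v, []) = 0"
  shows "decomp_in Q (arr Q ` arrs Q) S x r \<longleftrightarrow>
    (\<forall>\<alpha>\<in>arrs Q. ldiv Q \<alpha> x \<in> S) \<and>
    r = (\<lambda>z. if z \<in> arr Q ` arrs Q then ldiv Q (the_inv_into (arrs Q) (arr Q) z) x else 0)"
    (is "?L \<longleftrightarrow> ?R")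
proof -
  have inj: "inj_on (arr Q :: _ \<Rightarrow> ('a, 'b, 'c) pa) (arrs Q)" by (simp add: inj_on_def)
  note inv = the_inv_into_f_f[OF inj]
  have L: "?L \<longleftrightarrow> (\<forall>z. z \<notin> arr Q ` arrs Q \<longrightarrow> r z = 0) \<and>
     (\<forall>\<alpha>\<in>arrs Q. in_KQ Q (r (arr Q \<alpha>)) \<and> r (arr Q \<alpha>) \<in> S \<and> starts_at (tgt Q \<alpha>) (r (arr Q \<alpha>))) \<and>
     x = (\<Sum>\<alpha>\<in>arrs Q. conv Q (arr Q \<alpha>) (r (arr Q \<alpha>)))"
    using wf by (subst decomp_in_iff) (auto simp: in_KQ_arr uterm_arr sum.reindex inj)
  show ?thesis
  proof
    assume ?L
    then have r: "\<forall>z. z \<notin> arr Q ` arrs Q \<longrightarrow> r z = 0"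
      "\<forall>\<alpha>\<in>arrs Q. r (arr Q \<alpha>) \<in> S \<and> starts_at (tgt Q \<alpha>) (r (arr Q \<alpha>))"
      "x = (\<Sum>\<alpha>\<in>arrs Q. conv Q (arr Q \<alpha>) (r (arr Q \<alpha>)))"
      unfolding L by auto
    have "r (arr Q \<beta>) = ldiv Q \<beta> x" if "\<beta> \<in> arrs Q" for \<beta>
    proof -
      have "ldiv Q \<beta> x = (\<Sum>\<alpha>\<in>arrs Q. if \<beta> = \<alpha> then r (arr Q \<alpha>) else 0)"
        by (subst r(3)) (use r(2) in \<open>auto simp: ldiv_sum ldiv_conv_arr intro!: sum.cong\<close>)
      with that fin show ?thesis by simp
    qed
    with r(1,2) show ?R by (auto simp: fun_eq_iff inv)
  next
    assume ?R
    then show ?L unfolding L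
      using arrow_expansion[OF wf fin x] by (auto simp: inv in_KQ_ldiv wf x cong: sum.cong)
  qed
qed

lemma coef_arrow:
  assumes "wf_quiver Q" "finite (arrs Q)" "g 1 = arr Q ` arrs Q"
    "in_KQ Q x" "\<And>v. x (v, []) = 0" "\<alpha> \<in> arrs Q"
  shows "coef Q g 2 x (arr Q \<alpha>) = ldiv Q \<alpha> x"
proof -
  have inj: "inj_on (arr Q :: _ \<Rightarrow> ('a, 'b, 'c) pa) (arrs Q)" by (simp add: inj_on_def)
  have "coef Q g 2 x = (\<lambda>z. if z \<in> arr Q ` arrs Q
      then ldiv Q (the_inv_into (arrs Q) (arr Q) z) x else 0)"
    by (rule coef_eq) (use assms in \<open>simp add: decomp_in_arrows_iff\<close>)
  with assms(6) show ?thesis by (simp add: the_inv_into_f_f[OF inj])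
qed

text \<open>The vertices are orthogonal idempotents that together act on KQ as the identity, so
  multiplying by one of them isolates its coefficient.\<close>

lemma coef_vertex:
  assumes wf: "wf_quiver Q" and fin: "finite (verts Q)" and g: "g 0 = vtx ` verts Q"
    and x: "in_KQ Q x" and v: "v \<in> verts Q"
  shows "coef Q g 1 x (vtx v) = conv Q (vtx v) x"
proof -
  have inj: "inj_on (vtx :: _ \<Rightarrow> ('a, 'b, 'c) pa) (verts Q)" by (simp add: inj_on_def)
  note inv = the_inv_into_f_f[OF inj]
  have "coef Q g 1 x = (\<lambda>z. if z \<in> vtx ` verts Q
      then conv Q (vtx (the_inv_into (verts Q) vtx z)) x else 0)"
  proof (rule coef_eq)
    fix r
    have orth: "conv Q (vtx w) (conv Q (vtx v) y) = (if w = v then conv Q (vtx v) y else 0)"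
      for v w and y :: "('a, 'b, 'c) pa"
      by (auto simp: conv_vtx_left pointwise)
    have L: "decomp_in Q (g (1 - 1)) UNIV x r \<longleftrightarrow> (\<forall>z. z \<notin> vtx ` verts Q \<longrightarrow> r z = 0) \<and>
       (\<forall>v\<in>verts Q. in_KQ Q (r (vtx v)) \<and> r (vtx v) = conv Q (vtx v) (r (vtx v))) \<and>
       x = (\<Sum>v\<in>verts Q. conv Q (vtx v) (r (vtx v)))"
      using wf by (subst decomp_in_iff)
        (auto simp: g uterm_vtx sum.reindex inj starts_at_iff[of _ _ Q, symmetric])
    have sum_vtx: "x = (\<Sum>v\<in>verts Q. conv Q (vtx v) x)"
    proof
      fix p :: "'a \<times> 'b list"
      show "x p = (\<Sum>v\<in>verts Q. conv Q (vtx v) x) p"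
      proof (cases "x p = 0")
        case False
        then have "is_path Q p" using x by (simp add: in_KQ_def supp_def del: split_paired_All)
        then have "fst p \<in> verts Q" by (simp add: is_path_def)
        with fin show ?thesis by (simp add: sum_fun_apply conv_vtx_left)
      qed (simp add: sum_fun_apply conv_vtx_left cong: if_cong)
    qed
    show "decomp_in Q (g (1 - 1)) UNIV x r \<longleftrightarrow> r = (\<lambda>z. if z \<in> vtx ` verts Q
        then conv Q (vtx (the_inv_into (verts Q) vtx z)) x else 0)"
    proof
      assume "decomp_in Q (g (1 - 1)) UNIV x r"
      then have r: "\<forall>z. z \<notin> vtx ` verts Q \<longrightarrow> r z = 0"
        "\<And>v. v \<in> verts Q \<Longrightarrow> conv Q (vtx v) (r (vtx v)) = r (vtx v)"
        "x = (\<Sum>v\<in>verts Q. conv Q (vtx v) (r (vtx v)))"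
        unfolding L by auto
      have "r (vtx w) = conv Q (vtx w) x" if "w \<in> verts Q" for w
      proof -
        have "conv Q (vtx w) x = (\<Sum>v\<in>verts Q. if w = v then conv Q (vtx v) (r (vtx v)) else 0)"
          by (subst r(3)) (simp only: conv_sum_right orth)
        with that fin show ?thesis by (simp add: r(2))
      qed
      with r(1) show "r = (\<lambda>z. if z \<in> vtx ` verts Q
          then conv Q (vtx (the_inv_into (verts Q) vtx z)) x else 0)"
        by (auto simp: fun_eq_iff inv)
    next
      assume "r = (\<lambda>z. if z \<in> vtx ` verts Q
          then conv Q (vtx (the_inv_into (verts Q) vtx z)) x else 0)"
      then show "decomp_in Q (g (1 - 1)) UNIV x r"
        unfolding L using sum_vtx wf x
        by (auto simp: inv in_KQ_conv orth cong: sum.cong)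
    qed
  qed
  with v show ?thesis by (simp add: inv)
qed

declare One_nat_def [simp del]

section \<open>Exactness in degrees zero and one\<close>

text \<open>The obstruction to \<open>ldiv Q \<alpha> y \<in> I\<close> comes exactly from the summands \<open>x q\<close> of \<open>y\<close> in which
  no path precedes the generator \<open>x\<close>; \<open>h\<close> collects these \<open>q\<close>.\<close>
lemma ideal_gen_ldiv:
  assumes wf: "wf_quiver Q" and fin: "finite G"
    and G: "\<And>x. x \<in> G \<Longrightarrow> uniform Q x" "\<And>x v. x \<in> G \<Longrightarrow> x (v, []) = 0"
    and y: "y \<in> ideal_gen Q G"
  shows "\<exists>h. (\<forall>x. x \<notin> G \<longrightarrow> h x = 0) \<and> (\<forall>x\<in>G. in_KQ Q (h x) \<and> starts_at (uterm Q x) (h x)) \<and>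
    (\<forall>\<alpha>\<in>arrs Q. ldiv Q \<alpha> y - (\<Sum>x\<in>G. conv Q (ldiv Q \<alpha> x) (h x)) \<in> ideal_gen Q G)"
    (is "\<exists>h. ?P y h")
proof -
  have GK: "\<forall>x\<in>G. in_KQ Q x" using G by (auto simp: uniform_iff)
  have zeroP: "?P 0 (\<lambda>_. 0)" by simp
  show ?thesis
    using y GK wf
  proof (induction rule: ideal_gen_conv_induct)
    case zero
    show ?case using zeroP by (rule exI[of "?P 0" "\<lambda>_. 0"])
  next
    case (add x y)
    then obtain h k where h: "?P x h" and k: "?P y k" by blast
    have "?P (x + y) (\<lambda>z. h z + k z)"
    proof (intro conjI ballI)
      fix \<alpha> assume "\<alpha> \<in> arrs Q"
      then have "(ldiv Q \<alpha> x - (\<Sum>z\<in>G. conv Q (ldiv Q \<alpha> z) (h z))) +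
          (ldiv Q \<alpha> y - (\<Sum>z\<in>G. conv Q (ldiv Q \<alpha> z) (k z))) \<in> ideal_gen Q G"
        using h k by (intro ideal_gen_add) blast+
      then show "ldiv Q \<alpha> (x + y) - (\<Sum>z\<in>G. conv Q (ldiv Q \<alpha> z) (h z + k z)) \<in> ideal_gen Q G"
        by (simp add: ldiv_add conv_add_right sum.distrib algebra_simps)
    qed (use h k in \<open>auto intro: in_KQ_add starts_at_add\<close>)
    then show ?case by (rule exI[of "?P (x + y)"])
  next
    case (gen g p q c)
    obtain u as where p: "p = (u, as)" by fastforce
    let ?y = "psmult c (conv Q (conv Q (pth p) g) (pth q))"
    show ?case
    proof (cases as)
      case Nil
      obtain v where v: "starts_at v g" using G(1)[OF gen(1)] by (auto simp: uniform_iff)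
      have y: "?y = (if v = u then psmult c (conv Q g (pth q)) else 0)"
      proof (cases "v = u")
        case True
        then show ?thesis using v unfolding p Nil starts_at_iff[of _ _ Q] vtx_def by simp
      next
        case False
        have "conv Q (pth (u, [])) g = 0"
          by (rule conv_eq_zero_mismatch[OF _ v]) (use False in auto)
        then show ?thesis using False by (simp add: p Nil)
      qed
      \<comment> \<open>Unless the trivial path \<open>p\<close> and the path \<open>q\<close> both
        fit the generator, the product is zero. The second condition also makes \<open>pth q\<close>
        a legitimate value of \<open>h g\<close>, which has to start at
        \<open>uterm Q g\<close>.\<close>
      show ?thesis
      proof (cases "v = u \<and> uterm Q g = fst q")
        case True
        let ?h = "\<lambda>x. if x = g then psmult c (pth q) else 0"
        have "ldiv Q \<alpha> ?y = (\<Sum>x\<in>G. conv Q (ldiv Q \<alpha> x) (?h x))" for \<alpha>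
        proof -
          have "(\<Sum>x\<in>G. conv Q (ldiv Q \<alpha> x) (?h x)) =
              (\<Sum>x\<in>G. if x = g then conv Q (ldiv Q \<alpha> g) (psmult c (pth q)) else 0)"
            by (rule sum.cong) auto
          also have "\<dots> = conv Q (ldiv Q \<alpha> g) (psmult c (pth q))"
            using fin gen(1) by simp
          finally show ?thesis
            using True y G(2)[OF gen(1)] by (simp add: ldiv_psmult ldiv_conv conv_psmult_right)
        qed
        then have "?P ?y ?h"
          using gen True by (auto intro: starts_at_psmult in_KQ_psmult)
        then show ?thesis by (rule exI[of "?P ?y"])
      next
        case False
        have "?y = 0"
        proof (cases "v = u")
          case True
          with False have "uterm Q g \<noteq> fst q" by simp
          then have "conv Q g (pth q) = 0"
            using uterm_props(2)[OF G(1)[OF gen(1)]] by (intro conv_eq_zero_mismatch) auto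
          then show ?thesis unfolding y by simp
        qed (simp add: y)
        then show ?thesis using zeroP by (intro exI[of _ "\<lambda>_. 0"]) simp
      qed
    next
      case (Cons a bs)
      have a: "is_path Q (tgt Q a, bs)"
        using gen(2) unfolding p Cons by (simp add: is_path_Cons wf)
      \<comment> \<open>Division shortens the left path or kills the product, so the quotient is
        again a sandwiched generator or zero and needs no correction.\<close>
      have "ldiv Q \<alpha> ?y \<in> ideal_gen Q G" for \<alpha>
      proof -
        have "ldiv Q \<alpha> ?y = (if a = \<alpha> \<and> u = src Q \<alpha>
            then psmult c (conv Q (conv Q (pth (tgt Q \<alpha>, bs)) g) (pth q)) else 0)"
          by (simp add: ldiv_psmult p Cons conv_assoc ldiv_conv_pth_Cons)
        then show ?thesis using gen a GK wf by (auto simp: ideal_gen_gen)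
      qed
      then have "?P ?y (\<lambda>_. 0)" by simp
      then show ?thesis by (rule exI[of "?P ?y"])
    qed
  qed
qed

lemma min_gen_setD:
  assumes "min_gen_set Q I G"
  shows "finite G" "x \<in> G \<Longrightarrow> uniform Q x" "x \<in> G \<Longrightarrow> x \<noteq> 0" "ideal_gen Q G = I"
    "x \<in> G \<Longrightarrow> x \<notin> ideal_gen Q (G - {x})"
  using assms by (auto simp: min_gen_set_def pzero_eq_zero)

text \<open>No condition is put on \<open>g n\<close> for n \<ge> 3, so the locale can be
  instantiated for the stretched quiver before its higher degrees are known to give a
  resolution.\<close>

locale bound_quiver =
  fixes Q :: "('v, 'a) quiver" and I :: "('v, 'a, 'k::field) pa set"
    and g :: "nat \<Rightarrow> ('v, 'a, 'k) pa set"
  assumes wf: "wf_quiver Q" and finV: "finite (verts Q)" and finA: "finite (arrs Q)"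
    and adm: "admissible Q I"
    and g0: "g 0 = vtx ` verts Q" and g1: "g 1 = arr Q ` arrs Q"
    and gens: "min_gen_set Q I (g 2)"
begin

lemma ideal: "two_sided Q I"
  using adm by (simp add: admissible_iff)

lemma ideal_trivial: "x \<in> I \<Longrightarrow> x (v, []) = 0"
  using adm by (fastforce simp: admissible_iff supp_def)

lemma ideal_length_one: "x \<in> I \<Longrightarrow> x (v, [\<alpha>]) = 0"
  using adm by (fastforce simp: admissible_iff supp_def)

lemmas I_eq = min_gen_setD(4)[OF gens]

lemma g2D:
  assumes "x \<in> g 2"
  shows "uniform Q x" "in_KQ Q x" "x \<noteq> 0" "x \<in> I" "x (v, []) = 0"
proof -
  show u: "uniform Q x" and "x \<noteq> 0" using min_gen_setD[OF gens] assms by auto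
  then show "in_KQ Q x" by (simp add: uniform_iff)
  show "x \<in> I" using ideal_gen_superset[OF assms u wf] by (simp add: I_eq)
  then show "x (v, []) = 0" by (rule ideal_trivial)
qed

lemma inj_vtx: "inj_on (vtx :: _ \<Rightarrow> ('v, 'a, 'k) pa) S"
  by (simp add: inj_on_def)

lemma inj_arr: "inj_on (arr Q :: _ \<Rightarrow> ('v, 'a, 'k) pa) S"
  by (simp add: inj_on_def)

lemma coef1:
  assumes "\<alpha> \<in> arrs Q" "v \<in> verts Q"
  shows "coef Q g 1 (arr Q \<alpha>) (vtx v) = (if src Q \<alpha> = v then arr Q \<alpha> else 0)"
  using assms coef_vertex[where g = g, OF wf finV g0 in_KQ_arr[OF wf assms(1)] assms(2)]
  by (auto simp: arr_def vtx_def conv_pth_pth)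

lemma coef2:
  assumes "x \<in> g 2" "\<alpha> \<in> arrs Q"
  shows "coef Q g 2 x (arr Q \<alpha>) = ldiv Q \<alpha> x"
  by (rule coef_arrow[where g = g, OF wf finA g1]) (use assms g2D in auto)

lemma inP1D:
  assumes "inP Q g 1 f" "\<alpha> \<in> arrs Q"
  shows "in_KQ Q (f (arr Q \<alpha>))" "starts_at (tgt Q \<alpha>) (f (arr Q \<alpha>))"
  using assms uterm_arr[OF wf assms(2), where ?'k = 'k] by (auto simp: inP_iff g1 simp del: split_paired_All)

lemma dmap1:
  assumes "inP Q g 1 h" "v \<in> verts Q"
  shows "dmap Q g 1 h (vtx v) = (\<Sum>\<alpha>\<in>{\<alpha>\<in>arrs Q. src Q \<alpha> = v}. conv Q (arr Q \<alpha>) (h (arr Q \<alpha>)))"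
proof -
  have "dmap Q g 1 h (vtx v) = (\<Sum>x\<in>g 1. conv Q (coef Q g 1 x (vtx v)) (h x))"
    by (rule dmap_eq_conv)
      (use assms coef1[OF _ assms(2)] in \<open>auto simp: g0 g1 in_KQ_arr wf\<close>)
  also have "\<dots> = (\<Sum>\<alpha>\<in>arrs Q. conv Q (coef Q g 1 (arr Q \<alpha>) (vtx v)) (h (arr Q \<alpha>)))"
    by (simp add: g1 sum.reindex inj_arr)
  also have "\<dots> = (\<Sum>\<alpha>\<in>arrs Q. if src Q \<alpha> = v then conv Q (arr Q \<alpha>) (h (arr Q \<alpha>)) else 0)"
    by (rule sum.cong) (use coef1[OF _ assms(2)] in auto)
  also have "\<dots> = (\<Sum>\<alpha>\<in>{\<alpha>\<in>arrs Q. src Q \<alpha> = v}. conv Q (arr Q \<alpha>) (h (arr Q \<alpha>)))"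
    using finA by (simp add: sum.inter_filter)
  finally show ?thesis .
qed

lemma dmap2:
  assumes "inP Q g 2 h" "\<alpha> \<in> arrs Q"
  shows "dmap Q g 2 h (arr Q \<alpha>) = (\<Sum>x\<in>g 2. conv Q (ldiv Q \<alpha> x) (h x))"
proof -
  have "dmap Q g 2 h (arr Q \<alpha>) = (\<Sum>x\<in>g 2. conv Q (coef Q g 2 x (arr Q \<alpha>)) (h x))"
    by (rule dmap_eq_conv)
      (use assms g1 in \<open>auto simp: coef2 in_KQ_ldiv wf g2D simp flip: One_nat_def\<close>)
  also have "\<dots> = (\<Sum>x\<in>g 2. conv Q (ldiv Q \<alpha> x) (h x))"
    by (rule sum.cong) (use assms in \<open>auto simp: coef2\<close>)
  finally show ?thesis .
qed

lemma vtx_apply: "vtx v (v, []) = 1"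
  by (simp add: vtx_def pth_apply)

lemma dzero_surj: "\<exists>f. inP Q g 0 f \<and> (\<forall>v\<in>verts Q. dzero f v = c v)"
proof -
  define f where "f = (\<lambda>z. if z \<in> vtx ` verts Q
    then psmult (c (the_inv_into (verts Q) vtx z)) z else (0 :: ('v, 'a, 'k) pa))"
  have "f (vtx v) = psmult (c v) (vtx v)" if "v \<in> verts Q" for v
    using that by (simp add: f_def the_inv_into_f_f[OF inj_vtx])
  moreover have "f x = 0" if "x \<notin> vtx ` verts Q" for x
    using that by (simp add: f_def)
  ultimately have "inP Q g 0 f \<and> (\<forall>v\<in>verts Q. dzero f v = c v)"
    by (auto simp: inP_iff g0 dzero_def uterm_vtx wf psmult_apply vtx_apply
        intro!: in_KQ_psmult starts_at_psmult)
  then show ?thesis by blast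
qed

lemma vertex_part_expansion:
  assumes "in_KQ Q x" "\<And>v. x (v, []) = 0"
  shows "conv Q (vtx v) x = (\<Sum>\<alpha>\<in>{\<alpha>\<in>arrs Q. src Q \<alpha> = v}. conv Q (arr Q \<alpha>) (ldiv Q \<alpha> x))"
proof -
  have "conv Q (vtx v) x = (\<Sum>\<alpha>\<in>arrs Q. conv Q (conv Q (vtx v) (arr Q \<alpha>)) (ldiv Q \<alpha> x))"
    by (subst arrow_expansion[OF wf finA assms]) (simp add: conv_sum_right conv_assoc)
  also have "\<dots> = (\<Sum>\<alpha>\<in>arrs Q. if src Q \<alpha> = v then conv Q (arr Q \<alpha>) (ldiv Q \<alpha> x) else 0)"
    by (rule sum.cong) (auto simp: arr_def vtx_def conv_pth_pth)
  finally show ?thesis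
    using finA by (simp add: sum.inter_filter)
qed

text \<open>An element of the kernel has no trivial path at any vertex, so it is a combination of
  arrows, and the preimage found is exact, not only modulo I. Conversely, neither a boundary nor an
  element of I contains a trivial path.\<close>

lemma exact0:
  assumes f: "inP Q g 0 f"
  shows "(\<forall>v\<in>verts Q. dzero f v = 0) \<longleftrightarrow>
    (\<exists>h. inP Q g 1 h \<and> (\<forall>x. psub (f x) (dmap Q g 1 h x) \<in> I))"
proof
  assume zero: "\<forall>v\<in>verts Q. dzero f v = 0"
  define h where "h = (\<lambda>z :: ('v, 'a, 'k) pa. if z \<in> arr Q ` arrs Q
    then let \<alpha> = the_inv_into (arrs Q) (arr Q) z in ldiv Q \<alpha> (f (vtx (src Q \<alpha>)))
    else (0 :: ('v, 'a, 'k) pa))"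
  have h: "h (arr Q \<alpha>) = ldiv Q \<alpha> (f (vtx (src Q \<alpha>)))" if "\<alpha> \<in> arrs Q" for \<alpha>
    using that by (simp add: h_def the_inv_into_f_f[OF inj_arr] Let_def)
  have fK: "in_KQ Q (f (vtx v))" "starts_at v (f (vtx v))" if "v \<in> verts Q" for v
    using f that uterm_vtx[OF wf that, where ?'k = 'k] by (auto simp: inP_iff g0)
  have inPh: "inP Q g 1 h"
  proof -
    have "h x = 0" if "x \<notin> arr Q ` arrs Q" for x using that by (simp add: h_def)
    then show ?thesis
      using wf h by (auto simp: inP_iff g1 uterm_arr wf_quiver_def intro!: in_KQ_ldiv fK)
  qed
  have "psub (f x) (dmap Q g 1 h x) = 0" for x
  proof (cases "x \<in> g 0")
    case True
    then obtain v where v: "v \<in> verts Q" "x = vtx v" by (auto simp: g0)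
    have trivial: "f (vtx v) (u, []) = 0" for u
      using zero v fK(2)[of v] by (cases "u = v") (auto simp: dzero_def starts_at_def)
    have "f (vtx v) = conv Q (vtx v) (f (vtx v))"
      using fK(2)[OF v(1)] by (simp only: starts_at_iff[of _ _ Q])
    also have "\<dots> = dmap Q g 1 h (vtx v)"
      unfolding dmap1[OF inPh v(1)] vertex_part_expansion[OF fK(1)[OF v(1)] trivial]
      by (rule sum.cong) (use h in auto)
    finally show ?thesis by (simp add: v psub_eq_minus)
  next
    case False
    then have "f x = 0" using f by (simp add: inP_iff)
    then show ?thesis using False by (simp add: dmap_outside psub_eq_minus)
  qed
  with inPh show "\<exists>h. inP Q g 1 h \<and> (\<forall>x. psub (f x) (dmap Q g 1 h x) \<in> I)"
    using two_sidedD(2)[OF ideal] by (intro exI[of _ h]) simp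
next
  assume "\<exists>h. inP Q g 1 h \<and> (\<forall>x. psub (f x) (dmap Q g 1 h x) \<in> I)"
  then obtain h where h: "inP Q g 1 h" "\<And>x. f x - dmap Q g 1 h x \<in> I"
    by (auto simp: psub_eq_minus)
  show "\<forall>v\<in>verts Q. dzero f v = 0"
  proof
    fix v assume v: "v \<in> verts Q"
    have "(f (vtx v) - dmap Q g 1 h (vtx v)) (v, []) = 0"
      using h(2) by (rule ideal_trivial)
    moreover have "dmap Q g 1 h (vtx v) (v, []) = 0"
      using v h(1) by (simp add: dmap1 sum_fun_apply conv_arr)
    ultimately show "dzero f v = 0" by (simp add: dzero_def minus_apply)
  qed
qed

text \<open>For a cycle the combined element \<open>y\<close> lies in I. As I is generated by
  \<open>g 2\<close>, \<open>ideal_gen_ldiv\<close> says that the left quotients of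
  \<open>y\<close>, which are the entries of \<open>f\<close>, form a boundary modulo I.\<close>

lemma exact1:
  assumes f: "inP Q g 1 f"
  shows "(\<forall>z. dmap Q g 1 f z \<in> I) \<longleftrightarrow>
    (\<exists>h. inP Q g 2 h \<and> (\<forall>x. psub (f x) (dmap Q g 2 h x) \<in> I))"
proof
  assume A: "\<forall>z. dmap Q g 1 f z \<in> I"
  \<comment> \<open>This packs the family into one element: the entry at \<alpha> is recovered as
    the left quotient by \<alpha>, while sorting by source vertex gives the entries of
    \<open>dmap Q g 1 f\<close>.\<close>
  define y where "y = (\<Sum>\<alpha>\<in>arrs Q. conv Q (arr Q \<alpha>) (f (arr Q \<alpha>)))"
  have "y = (\<Sum>v\<in>verts Q. dmap Q g 1 f (vtx v))"
    unfolding y_def using finA finV wf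
    by (subst sum.group[where T = "verts Q" and g = "src Q", symmetric])
      (auto simp: dmap1[OF f] wf_quiver_def intro!: sum.cong)
  then have "y \<in> ideal_gen Q (g 2)"
    using A by (simp add: I_eq two_sided_sum[OF ideal])
  then obtain h where h: "\<forall>x. x \<notin> g 2 \<longrightarrow> h x = 0"
    "\<forall>x\<in>g 2. in_KQ Q (h x) \<and> starts_at (uterm Q x) (h x)"
    "\<And>\<alpha>. \<alpha> \<in> arrs Q \<Longrightarrow> ldiv Q \<alpha> y - (\<Sum>x\<in>g 2. conv Q (ldiv Q \<alpha> x) (h x)) \<in> I"
    using ideal_gen_ldiv[of Q "g 2" y] wf min_gen_setD(1)[OF gens] g2D(1,5) unfolding I_eq by blast
  have inPh: "inP Q g 2 h" using h by (simp add: inP_iff)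
  have "f x - dmap Q g 2 h x \<in> I" for x
  proof (cases "x \<in> g 1")
    case True
    then obtain \<alpha> where \<alpha>: "\<alpha> \<in> arrs Q" "x = arr Q \<alpha>" by (auto simp: g1)
    have "ldiv Q \<alpha> y = (\<Sum>\<beta>\<in>arrs Q. if \<alpha> = \<beta> then f (arr Q \<beta>) else 0)"
      unfolding y_def ldiv_sum by (rule sum.cong) (use inP1D(2)[OF f] in \<open>auto simp: ldiv_conv_arr\<close>)
    then have "ldiv Q \<alpha> y = f (arr Q \<alpha>)" using \<alpha> finA by simp
    with h(3)[OF \<alpha>(1)] show ?thesis by (simp add: \<alpha> dmap2[OF inPh])
  next
    case False
    then have "f x = 0" using f by (simp add: inP_iff)
    then show ?thesis
      using False two_sidedD(2)[OF ideal] dmap_outside[of x g 2] by (simp flip: One_nat_def)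
  qed
  with inPh show "\<exists>h. inP Q g 2 h \<and> (\<forall>x. psub (f x) (dmap Q g 2 h x) \<in> I)"
    by (auto simp: psub_eq_minus)
next
  assume "\<exists>h. inP Q g 2 h \<and> (\<forall>x. psub (f x) (dmap Q g 2 h x) \<in> I)"
  then obtain h where h: "inP Q g 2 h" "\<And>x. f x - dmap Q g 2 h x \<in> I"
    by (auto simp: psub_eq_minus)
  show "\<forall>z. dmap Q g 1 f z \<in> I"
  proof
    fix z
    show "dmap Q g 1 f z \<in> I"
    proof (cases "z \<in> g 0")
      case True
      then obtain v where v: "v \<in> verts Q" "z = vtx v" by (auto simp: g0)
      define S where "S = {\<alpha>\<in>arrs Q. src Q \<alpha> = v}"
      \<comment> \<open>\<open>f\<close> is split into its difference from the boundary of
        \<open>h\<close>, which lies in I, and that boundary, whose sum over the arrows leaving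
        \<open>v\<close> reassembles the generators.\<close>
      have "(\<Sum>\<alpha>\<in>S. conv Q (arr Q \<alpha>) (f (arr Q \<alpha>) - dmap Q g 2 h (arr Q \<alpha>))) \<in> I"
        using h(2) by (auto simp: S_def wf in_KQ_arr intro!: two_sided_sum[OF ideal] two_sidedD(6)[OF ideal])
      moreover have "(\<Sum>\<alpha>\<in>S. conv Q (arr Q \<alpha>) (dmap Q g 2 h (arr Q \<alpha>))) \<in> I"
      proof -
        have "(\<Sum>\<alpha>\<in>S. conv Q (arr Q \<alpha>) (dmap Q g 2 h (arr Q \<alpha>))) =
            (\<Sum>\<alpha>\<in>S. \<Sum>x\<in>g 2. conv Q (conv Q (arr Q \<alpha>) (ldiv Q \<alpha> x)) (h x))"
          by (rule sum.cong) (auto simp: S_def dmap2[OF h(1)] conv_sum_right conv_assoc)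
        also have "\<dots> = (\<Sum>x\<in>g 2. conv Q (\<Sum>\<alpha>\<in>S. conv Q (arr Q \<alpha>) (ldiv Q \<alpha> x)) (h x))"
          by (subst sum.swap) (simp add: conv_sum_left)
        also have "\<dots> = (\<Sum>x\<in>g 2. conv Q (conv Q (vtx v) x) (h x))"
          by (rule sum.cong) (auto simp: S_def vertex_part_expansion g2D)
        also have "\<dots> \<in> I"
        proof (rule two_sided_sum[OF ideal])
          fix x assume x: "x \<in> g 2"
          have "conv Q (vtx v) x \<in> I"
            using two_sidedD(6)[OF ideal g2D(4)[OF x]] v(1) by simp
          then show "conv Q (conv Q (vtx v) x) (h x) \<in> I"
            by (rule two_sidedD(5)[OF ideal]) (use h(1) x in \<open>simp add: inP_iff\<close>)
        qed
        finally show ?thesis .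
      qed
      ultimately have "(\<Sum>\<alpha>\<in>S. conv Q (arr Q \<alpha>) (f (arr Q \<alpha>) - dmap Q g 2 h (arr Q \<alpha>))) +
          (\<Sum>\<alpha>\<in>S. conv Q (arr Q \<alpha>) (dmap Q g 2 h (arr Q \<alpha>))) \<in> I"
        by (rule two_sidedD(3)[OF ideal])
      then show ?thesis
        by (simp add: v dmap1[OF f] S_def conv_diff_right sum_subtractf)
    next
      case False
      then show ?thesis using two_sidedD(2)[OF ideal] by (simp add: dmap_outside)
    qed
  qed
qed

lemma minimal1:
  assumes "x \<in> g 1" "z \<in> g 0"
  shows "coef Q g 1 x z (v, []) = 0"
proof -
  obtain \<alpha> u where "\<alpha> \<in> arrs Q" "x = arr Q \<alpha>" "u \<in> verts Q" "z = vtx u"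
    using assms unfolding g0 g1 by blast
  then show ?thesis by (simp add: coef1 zero_fun_apply) (simp add: arr_def pth_apply)
qed

text \<open>Elements of an admissible ideal contain no path of length one, so dividing them by an
  arrow leaves no trivial path.\<close>

lemma minimal2:
  assumes "x \<in> g 2" "z \<in> g 1"
  shows "coef Q g 2 x z (v, []) = 0"
  using assms g2D(4)[OF assms(1)] unfolding g1
  by (auto simp: coef2 ldiv_def ideal_length_one)

end

declare upt_Suc [simp del]

section \<open>Paths in the stretched quiver\<close>

definition block :: "nat \<Rightarrow> 'a \<Rightarrow> ('a \<times> nat) list" where
  "block A \<alpha> = map (Pair \<alpha>) [1..<Suc A]"

definition theta_list :: "nat \<Rightarrow> 'a list \<Rightarrow> ('a \<times> nat) list" where
  "theta_list A cs = concat (map (block A) cs)"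

lemma theta_path_eq:
  fixes p :: "'v \<times> 'a list"
  shows "theta_path A p = (Inl (fst p), theta_list A (snd p))"
proof -
  have "block A = (\<lambda>\<alpha> :: 'a. map (\<lambda>j. (\<alpha>, j)) [1..<Suc A])" by (simp add: block_def fun_eq_iff)
  then show ?thesis by (simp only: theta_path_def theta_list_def)
qed

lemma length_block [simp]: "length (block A \<alpha>) = A"
  by (simp add: block_def)

lemma theta_list_simps [simp]:
  "theta_list A [] = []" "theta_list A (c # cs) = block A c @ theta_list A cs"
  by (simp_all add: theta_list_def)

lemma length_theta_list [simp]: "length (theta_list A cs) = A * length cs"
  by (induction cs) auto

lemma take_theta_list:
  "k \<le> length cs \<Longrightarrow> take (A * k) (theta_list A cs @ ts) = theta_list A (take k cs)"
proof (induction cs arbitrary: k)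
  case (Cons c cs)
  then show ?case by (cases k) auto
qed simp

lemma drop_theta_list:
  "k \<le> length cs \<Longrightarrow> drop (A * k) (theta_list A cs @ ts) = theta_list A (drop k cs) @ ts"
proof (induction cs arbitrary: k)
  case (Cons c cs)
  then show ?case by (cases k) auto
qed simp

locale stretching =
  fixes Q :: "('v, 'a) quiver" and A :: nat
  assumes wf: "wf_quiver Q" and finV: "finite (verts Q)" and finA: "finite (arrs Q)"
    and A_ge_1: "A \<ge> 1"
begin

abbreviation S :: "('v + 'a \<times> nat, 'a \<times> nat) quiver" where
  "S \<equiv> stretch Q A"

lemma verts_S: "verts S = Inl ` verts Q \<union> {Inr (\<alpha>, j) | \<alpha> j. \<alpha> \<in> arrs Q \<and> 1 \<le> j \<and> j < A}"
  by (auto simp: stretch_def)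

lemma Inl_in_verts_S [simp]: "Inl v \<in> verts S \<longleftrightarrow> v \<in> verts Q"
  by (auto simp: verts_S)

lemma Inr_in_verts_S [simp]: "Inr (\<alpha>, j) \<in> verts S \<longleftrightarrow> \<alpha> \<in> arrs Q \<and> 1 \<le> j \<and> j < A"
  by (auto simp: verts_S)

lemma arrs_S: "(\<alpha>, j) \<in> arrs S \<longleftrightarrow> \<alpha> \<in> arrs Q \<and> 1 \<le> j \<and> j \<le> A"
  by (auto simp: stretch_def)

lemma src_S: "src S (\<alpha>, j) = (if j = 1 then Inl (src Q \<alpha>) else Inr (\<alpha>, j - 1))"
  by (simp add: stretch_def)

lemma tgt_S: "tgt S (\<alpha>, j) = (if j = A then Inl (tgt Q \<alpha>) else Inr (\<alpha>, j))"
  by (simp add: stretch_def)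

lemma wf_S: "wf_quiver S"
  using wf by (auto simp: wf_quiver_def arrs_S src_S tgt_S)

lemma finite_arrs_S: "finite (arrs S)"
proof (rule finite_subset)
  show "arrs S \<subseteq> arrs Q \<times> {..A}" by (auto simp: stretch_def)
qed (simp add: finA)

lemma finite_verts_S: "finite (verts S)"
proof (rule finite_subset)
  show "verts S \<subseteq> Inl ` verts Q \<union> Inr ` (arrs Q \<times> {..A})" by (auto simp: verts_S)
qed (simp add: finA finV)

lemma block_Cons: "block A \<alpha> = (\<alpha>, 1) # map (Pair \<alpha>) [2..<Suc A]"
  using A_ge_1 by (simp add: block_def upt_conv_Cons)

lemma block_inject [simp]: "block A \<alpha> = block A \<beta> \<longleftrightarrow> \<alpha> = \<beta>"
  by (auto simp: block_Cons)

lemma theta_list_inject [simp]: "theta_list A cs = theta_list A ds \<longleftrightarrow> cs = ds"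
proof
  assume eq: "theta_list A cs = theta_list A ds"
  then have "A * length cs = A * length ds" by (metis length_theta_list)
  then have "length cs = length ds" using A_ge_1 by simp
  then show "cs = ds" using eq by (induction cs ds rule: list_induct2) auto
qed simp

text \<open>Dividing the total length by \<open>A\<close> recovers the number of blocks, since the
  remainders are shorter than \<open>A\<close>; blocks and remainders then match separately.\<close>

lemma theta_tail_inject:
  assumes "theta_list A cs @ ts = theta_list A ds @ us" "length ts < A" "length us < A"
  shows "cs = ds" "ts = us"
proof -
  have "A * length cs + length ts = A * length ds + length us"
    using arg_cong[OF assms(1), of length] by simp
  then have "(A * length cs + length ts) div A = (A * length ds + length us) div A" by simp
  then have "length cs = length ds" using assms(2,3) by simp
  then have "length (theta_list A cs) = length (theta_list A ds)" by simp
  with assms(1) show "cs = ds" "ts = us" by simp_all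
qed

lemma inj_theta_path: "inj (theta_path A)"
  by (auto simp: inj_def theta_path_eq)

lemma segment_path:
  assumes "\<alpha> \<in> arrs Q" "1 \<le> i" "i \<le> j" "j \<le> A"
  shows "is_path S (src S (\<alpha>, i), map (Pair \<alpha>) [i..<Suc j]) \<and>
    path_end S (src S (\<alpha>, i), map (Pair \<alpha>) [i..<Suc j]) = tgt S (\<alpha>, j)"
  using assms(3,4)
proof (induction j rule: dec_induct)
  case base
  then have "(\<alpha>, i) \<in> arrs S" using assms by (simp add: arrs_S)
  then show ?case by (simp add: is_path_arr wf_S upt_Suc)
next
  case (step j)
  then have "(\<alpha>, Suc j) \<in> arrs S" using assms by (simp add: arrs_S)
  moreover have "tgt S (\<alpha>, j) = src S (\<alpha>, Suc j)" using step assms by (simp add: src_S tgt_S)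
  moreover have "[i..<Suc (Suc j)] = [i..<Suc j] @ [Suc j]" using step by (simp add: upt_Suc)
  ultimately show ?case using step
    by (simp add: is_path_append wf_S is_path_arr path_end_append)
qed

lemma block_path:
  assumes "\<alpha> \<in> arrs Q"
  shows "is_path S (Inl (src Q \<alpha>), block A \<alpha>)"
  using segment_path[OF assms, of 1 A] A_ge_1 by (simp add: block_def src_S)

lemma path_end_block: "path_end S (u, block A \<alpha>) = Inl (tgt Q \<alpha>)"
  using A_ge_1 by (simp add: block_def path_end_def tgt_S upt_Suc)

lemma path_end_theta: "path_end S (Inl v, theta_list A cs) = Inl (path_end Q (v, cs))"
  by (induction cs arbitrary: v) (simp_all add: path_end_append path_end_block)

lemma is_path_theta: "is_path Q (v, cs) \<Longrightarrow> is_path S (Inl v, theta_list A cs)"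
  by (induction cs arbitrary: v)
    (auto simp: is_path_Cons wf is_path_append wf_S block_path path_end_block)

text \<open>A new vertex has a single outgoing arrow, so a path that has entered a stretched arrow
  is forced to follow it. The bound on the length stops it no later than the end of that arrow,
  where the choice is free again.\<close>

lemma path_walk:
  assumes "is_path S (u, (\<alpha>, i) # as)" "length as \<le> A - i"
  shows "as = map (Pair \<alpha>) [Suc i..<Suc i + length as]"
  using assms
proof (induction as arbitrary: u i)
  case (Cons b bs)
  obtain \<beta> j where b: "b = (\<beta>, j)" by fastforce
  have "is_path S (tgt S (\<alpha>, i), (\<beta>, j) # bs)" "i \<noteq> A"
    using Cons.prems by (auto simp: is_path_Cons[OF wf_S] b)
  moreover from this have "(\<beta>, j) \<in> arrs S" "src S (\<beta>, j) = Inr (\<alpha>, i)"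
    by (auto simp: is_path_Cons[OF wf_S] tgt_S)
  then have "\<beta> = \<alpha>" "j = Suc i" by (auto simp: src_S arrs_S split: if_splits)
  ultimately have "bs = map (Pair \<alpha>) [Suc (Suc i)..<Suc (Suc i) + length bs]"
    using Cons.IH[of "tgt S (\<alpha>, i)" "Suc i"] Cons.prems(2) by simp
  moreover have "[Suc i..<Suc i + length (b # bs)] = Suc i # [Suc (Suc i)..<Suc (Suc i) + length bs]"
    by (simp add: upt_rec)
  ultimately show ?case by (simp add: b \<open>\<beta> = \<alpha>\<close> \<open>j = Suc i\<close>)
qed simp

text \<open>The paths that start at an old vertex and stop before completing a stretched arrow, each
  stored with its starting vertex in \<open>Q\<close>. The starting vertex is redundant unless the tail is empty;
  it makes \<open>comp\<close> treat both kinds of tail alike.\<close>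
definition tails :: "('v \<times> ('a \<times> nat) list) set" where
  "tails = {(v, []) | v. v \<in> verts Q} \<union>
     {(src Q \<alpha>, map (Pair \<alpha>) [1..<Suc j]) | \<alpha> j. \<alpha> \<in> arrs Q \<and> 1 \<le> j \<and> j < A}"

lemma finite_tails: "finite tails"
proof -
  have "tails \<subseteq> (\<lambda>v. (v, [])) ` verts Q \<union>
      (\<lambda>(\<alpha>, j). (src Q \<alpha>, map (Pair \<alpha>) [1..<Suc j])) ` (arrs Q \<times> {..A})"
    unfolding tails_def by (rule Un_mono) (blast, force simp: image_iff)
  then show ?thesis by (rule finite_subset) (simp add: finA finV)
qed

lemma tailsD:
  assumes "t \<in> tails"
  shows "length (snd t) < A" "is_path S (Inl (fst t), snd t)" "fst t \<in> verts Q"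
    "path_end S (Inl (fst t), snd t) = Inl w \<Longrightarrow> snd t = []"
proof -
  consider v where "v \<in> verts Q" "t = (v, [])" |
    \<alpha> j where "\<alpha> \<in> arrs Q" "1 \<le> j" "j < A" "t = (src Q \<alpha>, map (Pair \<alpha>) [1..<Suc j])"
    using assms by (auto simp: tails_def)
  then have "length (snd t) < A \<and> is_path S (Inl (fst t), snd t) \<and> fst t \<in> verts Q \<and>
    (path_end S (Inl (fst t), snd t) = Inl w \<longrightarrow> snd t = [])"
  proof cases
    case 1
    then show ?thesis using A_ge_1 by simp
  next
    case 2
    then show ?thesis
      using segment_path[of \<alpha> 1 j] wf by (simp add: src_S tgt_S wf_quiver_def)
  qed
  then show "length (snd t) < A" "is_path S (Inl (fst t), snd t)" "fst t \<in> verts Q"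
    "path_end S (Inl (fst t), snd t) = Inl w \<Longrightarrow> snd t = []" by auto
qed

lemma tail_path: "(v, ts) \<in> tails \<Longrightarrow> is_path S (Inl v, ts)"
  using tailsD(2) by fastforce

text \<open>Existence of the splitting whose uniqueness is \<open>theta_tail_inject\<close>: full
  blocks are removed from the front until fewer than \<open>A\<close> arrows are left.\<close>

lemma path_cases:
  assumes "is_path S (Inl v, as)"
  shows "\<exists>cs ts. as = theta_list A cs @ ts \<and> is_path Q (v, cs) \<and> (path_end Q (v, cs), ts) \<in> tails"
  using assms
proof (induction "length as" arbitrary: v as rule: less_induct)
  case less
  show ?case
  proof (cases as)
    case Nil
    then have "v \<in> verts Q" using less.prems by simp
    then show ?thesis using Nil
      by (intro exI[of _ "[]"]) (auto simp: tails_def)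
  next
    case (Cons b bs)
    obtain \<alpha> i where b: "b = (\<alpha>, i)" by fastforce
    have i: "i = 1" "src Q \<alpha> = v" "\<alpha> \<in> arrs Q"
      using less.prems unfolding Cons b
      by (auto simp: is_path_Cons[OF wf_S] src_S arrs_S split: if_splits)
    show ?thesis
    proof (cases "length as < A")
      case True
      have "bs = map (Pair \<alpha>) [2..<Suc (length as)]"
        using path_walk[of "Inl v" \<alpha> i bs] less.prems True unfolding Cons b i
        by simp
      then have "as = map (Pair \<alpha>) [1..<Suc (length as)]"
        by (simp add: Cons b i upt_conv_Cons)
      then have "(v, as) \<in> tails"
        unfolding tails_def using i True Cons
        by (intro UnI2 CollectI exI[of _ \<alpha>] exI[of _ "length as"]) simp
      moreover have "v \<in> verts Q" using less.prems by (simp add: is_path_def)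
      ultimately show ?thesis by (intro exI[of _ "[]"] exI[of _ as]) simp
    next
      case False
      \<comment> \<open>The first \<open>A\<close> arrows turn out to be the block of \<alpha>. It
        ends at an old vertex, so the induction hypothesis applies to the rest.\<close>
      have split: "is_path S (Inl v, take A as @ drop A as)" using less.prems by simp
      then have "is_path S (Inl v, take A as)" and
        rest: "is_path S (path_end S (Inl v, take A as), drop A as)"
        unfolding is_path_append[OF wf_S] by auto
      moreover have takeA: "take A as = (\<alpha>, 1) # take (A - 1) bs"
        using A_ge_1 by (cases A) (auto simp: Cons b i)
      moreover have len: "length (take (A - 1) bs) = A - 1" using False Cons by simp
      ultimately have "take (A - 1) bs = map (Pair \<alpha>) [Suc 1..<Suc 1 + (A - 1)]"
        using path_walk[of "Inl v" \<alpha> 1 "take (A - 1) bs"] by (simp only: len)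
      then have block: "take A as = block A \<alpha>"
        using A_ge_1 by (simp add: takeA block_Cons)
      have "length (drop A as) < length as" using A_ge_1 Cons by simp
      then obtain cs ts where "drop A as = theta_list A cs @ ts" "is_path Q (tgt Q \<alpha>, cs)"
        "(path_end Q (tgt Q \<alpha>, cs), ts) \<in> tails"
        using less.hyps[of "drop A as" "tgt Q \<alpha>"] rest by (auto simp: block path_end_block)
      moreover have "as = block A \<alpha> @ drop A as" by (metis append_take_drop_id block)
      ultimately show ?thesis
        using i by (intro exI[of _ "\<alpha> # cs"] exI[of _ ts]) (simp add: is_path_Cons wf)
    qed
  qed
qed

lemma is_path_thetaD:
  assumes "is_path S (Inl v, theta_list A cs @ ts)" "length ts < A"
  shows "is_path Q (v, cs)"
  using path_cases[OF assms(1)] theta_tail_inject assms(2) tailsD(1) by fastforce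

text \<open>A nonempty tail ends at a new vertex. Hence the paths between old vertices are the
  stretched paths, and \<open>\<theta>\<^sup>*\<close> identifies KQ with the corner of the
  stretched path algebra cut out by the old vertices.\<close>

lemma path_between_old:
  assumes "is_path S (Inl v, as)" "path_end S (Inl v, as) = Inl w"
  obtains cs where "as = theta_list A cs" "is_path Q (v, cs)"
proof -
  obtain cs ts where *: "as = theta_list A cs @ ts" "is_path Q (v, cs)" "(path_end Q (v, cs), ts) \<in> tails"
    using path_cases[OF assms(1)] by blast
  moreover have "ts = []"
    using tailsD(4)[OF *(3), of w] assms(2) unfolding *(1) path_end_append path_end_theta by simp
  ultimately show thesis using that by simp
qed

section \<open>The homomorphism into the stretched path algebra\<close>

text \<open>Agrees with \<open>thetastar\<close> on finitely supported functions, but is linear on all functions.\<close>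
definition th :: "('v, 'a, 'k::field) pa \<Rightarrow> ('v + 'a \<times> nat, 'a \<times> nat, 'k) pa" where
  "th x = (\<lambda>q. if q \<in> range (theta_path A) then x (inv (theta_path A) q) else 0)"

lemma th_theta_path: "th x (Inl v, theta_list A cs) = x (v, cs)"
proof -
  have "(Inl v, theta_list A cs) = theta_path A (v, cs)" by (simp add: theta_path_eq)
  then show ?thesis by (simp add: th_def inv_f_f inj_theta_path)
qed

lemma th_outside: "(\<And>v cs. q \<noteq> (Inl v, theta_list A cs)) \<Longrightarrow> th x q = 0"
  by (auto simp: th_def theta_path_eq)

lemma th_nonzeroE:
  assumes "th x q \<noteq> 0"
  obtains v cs where "q = (Inl v, theta_list A cs)" "x (v, cs) \<noteq> 0"
  using assms th_outside[of q x] th_theta_path by metis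

lemma thetastar_eq_th:
  assumes "finite (supp x)"
  shows "thetastar A x = th x"
proof
  fix q :: "('v + 'a \<times> nat) \<times> ('a \<times> nat) list"
  show "thetastar A x q = th x q"
  proof (cases "q \<in> range (theta_path A)")
    case True
    then obtain p where p: "q = theta_path A p" by blast
    have "thetastar A x q = (\<Sum>p'\<in>supp x. if p' = p then x p else 0)"
      unfolding thetastar_def p by (rule sum.cong) (auto simp: inj_eq[OF inj_theta_path])
    also have "\<dots> = x p" using assms by (simp add: supp_def)
    finally show ?thesis using True by (simp add: th_def p inv_f_f inj_theta_path)
  next
    case False
    then show ?thesis by (auto simp: thetastar_def th_def intro!: sum.neutral)
  qed
qed

lemma th_zero [simp]: "th 0 = 0"
  by (simp add: th_def pointwise)

lemma th_add: "th (x + y) = th x + th y"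
  by (simp add: th_def pointwise)

lemma th_psmult: "th (psmult c x) = psmult c (th x)"
  by (simp add: th_def pointwise)

lemma th_sum: "th (\<Sum>a\<in>F. f a) = (\<Sum>a\<in>F. th (f a))"
  by (induction F rule: infinite_finite_induct) (auto simp: th_add)

lemma th_inject: "th x = th y \<longleftrightarrow> x = y"
proof
  assume "th x = th y"
  then have "x (v, cs) = y (v, cs)" for v cs by (metis th_theta_path)
  then show "x = y" by auto
qed simp

lemma th_eq_zero_iff [simp]: "th x = 0 \<longleftrightarrow> x = 0"
  by (metis th_inject th_zero)

lemma th_pth: "th (pth (v, cs) :: ('v, 'a, 'k::field) pa) = pth (Inl v, theta_list A cs)"
proof
  fix q
  show "th (pth (v, cs) :: ('v, 'a, 'k) pa) q = pth (Inl v, theta_list A cs) q"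
  proof (cases "\<exists>w ds. q = (Inl w, theta_list A ds)")
    case True
    then show ?thesis by (auto simp: th_theta_path pth_apply split: if_splits)
  next
    case False
    then show ?thesis by (auto simp: th_outside pth_apply)
  qed
qed

text \<open>\<open>th x\<close> vanishes on a prefix that does not consist of full blocks, so only
  cuts at multiples of \<open>A\<close> contribute. Taking \<open>y\<close> in the image of
  \<open>th\<close> shows that \<open>th\<close> is multiplicative; arbitrary \<open>y\<close> shows
  that components along tails are left linear.\<close>

lemma conv_th:
  assumes "length ts < A"
  shows "conv S (th x) y (Inl v, theta_list A cs @ ts) =
    (\<Sum>k\<le>length cs. x (v, take k cs) *
      y (Inl (path_end Q (v, take k cs)), theta_list A (drop k cs) @ ts))"
proof -
  define F where "F = (\<lambda>i. th x (Inl v, take i (theta_list A cs @ ts)) *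
    y (path_end S (Inl v, take i (theta_list A cs @ ts)), drop i (theta_list A cs @ ts)))"
  have inj: "inj_on ((*) A) {..length cs}" using A_ge_1 by (simp add: inj_on_def)
  have "conv S (th x) y (Inl v, theta_list A cs @ ts) = (\<Sum>i\<le>A * length cs + length ts. F i)"
    by (simp add: conv_def F_def)
  also have "\<dots> = (\<Sum>i\<in>(*) A ` {..length cs}. F i)"
  proof (rule sum.mono_neutral_right)
    show "\<forall>i\<in>{..A * length cs + length ts} - (*) A ` {..length cs}. F i = 0"
    proof (rule ballI, rule ccontr)
      fix i assume i: "i \<in> {..A * length cs + length ts} - (*) A ` {..length cs}" and "F i \<noteq> 0"
      then have "th x (Inl v, take i (theta_list A cs @ ts)) \<noteq> 0" by (auto simp: F_def)
      then obtain ds where "take i (theta_list A cs @ ts) = theta_list A ds"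
        by (rule th_nonzeroE) auto
      from arg_cong[OF this, of length] have ds: "i = A * length ds"
        using i by (simp del: take_append add: min_def split: if_splits)
      \<comment> \<open>Here the tail has to be shorter than a block: otherwise a cut at a multiple
        of \<open>A\<close> could fall inside it or at its end.\<close>
      then have "A * length ds < A * Suc (length cs)" using i assms by simp
      then have "length ds \<le> length cs" unfolding mult_less_cancel1 by simp
      with i ds show False by auto
    qed
    show "(*) A ` {..length cs} \<subseteq> {..A * length cs + length ts}"
      by (auto intro: trans_le_add1)
  qed simp
  also have "\<dots> = (\<Sum>k\<le>length cs. F (A * k))"
    by (simp add: sum.reindex inj)
  also have "\<dots> = (\<Sum>k\<le>length cs. x (v, take k cs) *
      y (Inl (path_end Q (v, take k cs)), theta_list A (drop k cs) @ ts))"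
    by (rule sum.cong)
      (simp_all add: F_def take_theta_list drop_theta_list th_theta_path path_end_theta
        del: take_append drop_append)
  finally show ?thesis .
qed

lemma th_conv: "th (conv Q x y) = conv S (th x) (th y)"
proof
  fix q
  show "th (conv Q x y) q = conv S (th x) (th y) q"
  proof (cases "\<exists>w ds. q = (Inl w, theta_list A ds)")
    case True
    then obtain w ds where q: "q = (Inl w, theta_list A ds)" by blast
    have "conv S (th x) (th y) q = conv Q x y (w, ds)"
      using conv_th[of "[]" x "th y" w ds] A_ge_1 by (simp add: q th_theta_path conv_def)
    then show ?thesis by (simp add: q th_theta_path)
  next
    case False
    have "conv S (th x) (th y) q = 0"
    proof (rule ccontr)
      assume "conv S (th x) (th y) q \<noteq> 0"
      then have "q \<in> supp (conv S (th x) (th y))" by (simp add: supp_def)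
      then show False
      proof (rule supp_convE)
        fix v as bs
        assume "q = (v, as @ bs)" "(v, as) \<in> supp (th x)" "(path_end S (v, as), bs) \<in> supp (th y)"
        then obtain w cs ds where "q = (Inl w, theta_list A cs @ theta_list A ds)"
          by (auto simp: supp_def elim!: th_nonzeroE)
        then have "q = (Inl w, theta_list A (cs @ ds))" by (simp add: theta_list_def)
        with False show False by blast
      qed
    qed
    then show ?thesis using False by (auto simp: th_outside)
  qed
qed

lemma in_KQ_th:
  assumes "in_KQ Q x"
  shows "in_KQ S (th x)"
proof -
  have "supp (th x) \<subseteq> theta_path A ` supp x"
    by (force simp: supp_def theta_path_eq elim!: th_nonzeroE)
  then have "finite (supp (th x))"
    by (rule finite_subset) (intro finite_imageI in_KQ_finite[OF assms])
  moreover have "is_path S q" if "q \<in> supp (th x)" for q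
    using that assms by (auto simp: supp_def in_KQ_def elim!: th_nonzeroE intro: is_path_theta)
  ultimately show ?thesis by (simp add: in_KQ_def)
qed

lemma starts_at_th: "starts_at v x \<Longrightarrow> starts_at (Inl v) (th x)"
  by (auto simp: starts_at_def elim!: th_nonzeroE)

lemma ends_at_th: "ends_at Q v x \<Longrightarrow> ends_at S (Inl v) (th x)"
  by (auto simp: ends_at_def path_end_theta elim!: th_nonzeroE)

lemma uniform_th: "uniform Q x \<Longrightarrow> uniform S (th x)"
  by (force simp: uniform_iff intro: in_KQ_th starts_at_th ends_at_th)

lemma uterm_th: "uniform Q x \<Longrightarrow> x \<noteq> 0 \<Longrightarrow> uterm S (th x) = Inl (uterm Q x)"
  by (intro uterm_eqI uniform_th ends_at_th uterm_props) auto

section \<open>Components along tails\<close>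

text \<open>The left factor of the summand of \<open>y\<close> that belongs to the tail
  \<open>t\<close>. Without the test on the end of \<open>p\<close>, all empty tails would give the
  same component.\<close>

definition comp :: "'v \<times> ('a \<times> nat) list \<Rightarrow> ('v + 'a \<times> nat, 'a \<times> nat, 'k::field) pa \<Rightarrow> ('v, 'a, 'k) pa" where
  "comp t y = (\<lambda>p. if path_end Q p = fst t then y (Inl (fst p), theta_list A (snd p) @ snd t) else 0)"

lemma comp_zero [simp]: "comp t 0 = 0"
  by (simp add: comp_def pointwise)

lemma comp_add: "comp t (x + y) = comp t x + comp t y"
  by (simp add: comp_def pointwise)

lemma comp_diff: "comp t (x - y) = comp t x - comp t y"
  by (simp add: comp_def pointwise)

lemma comp_psmult: "comp t (psmult c x) = psmult c (comp t x)"
  by (simp add: comp_def pointwise)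

lemma comp_sum: "comp t (\<Sum>a\<in>F. f a) = (\<Sum>a\<in>F. comp t (f a))"
  by (induction F rule: infinite_finite_induct) (auto simp: comp_add)

lemma in_KQ_comp:
  assumes "in_KQ S y" "t \<in> tails"
  shows "in_KQ Q (comp t y)"
proof -
  let ?f = "\<lambda>p. (Inl (fst p), theta_list A (snd p) @ snd t)"
  have "inj ?f" by (auto simp: inj_def)
  then have "finite (?f -` supp y)" by (intro finite_vimageI in_KQ_finite[OF assms(1)])
  moreover have "supp (comp t y) \<subseteq> ?f -` supp y" by (auto simp: supp_def comp_def split: if_splits)
  ultimately have "finite (supp (comp t y))" by (rule finite_subset[rotated])
  moreover have "is_path Q p" if "p \<in> supp (comp t y)" for p
  proof -
    have "is_path S (?f p)"
      using that assms(1) unfolding in_KQ_def by (auto simp: supp_def comp_def split: if_splits)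
    then show ?thesis using is_path_thetaD[of "fst p" "snd p" "snd t"] tailsD(1)[OF assms(2)] by simp
  qed
  ultimately show ?thesis by (simp add: in_KQ_def)
qed

lemma starts_at_comp: "starts_at (Inl v) y \<Longrightarrow> starts_at v (comp t y)"
  by (auto simp: starts_at_def comp_def)

lemma comp_starts_at_new: "starts_at (Inr b) y \<Longrightarrow> comp t y = 0"
  by (auto simp: starts_at_def comp_def pointwise)

lemma conv_comp_vtx: "conv Q (comp t y) (vtx (fst t)) = comp t y"
  by (auto simp: conv_vtx_right comp_def)

text \<open>Cuts inside the tail do not contribute to a product with \<open>th x\<close>, so the
  tail is a passive right end. This linearity is what reduces statements on stretched differentials
  to Q.\<close>

lemma comp_conv_th:
  assumes "t \<in> tails"
  shows "comp t (conv S (th x) y) = conv Q x (comp t y)"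
proof
  fix p :: "'v \<times> 'a list"
  obtain v cs where p: "p = (v, cs)" by fastforce
  show "comp t (conv S (th x) y) p = conv Q x (comp t y) p"
    using tailsD(1)[OF assms]
    by (simp add: comp_def conv_th p) (simp add: conv_def comp_def)
qed

lemma comp_pth_tail:
  assumes "t \<in> tails" "t' \<in> tails"
  shows "comp t (pth (Inl (fst t'), snd t')) = (if t = t' then vtx (fst t) else 0)"
proof
  fix p :: "'v \<times> 'a list"
  obtain v cs where p: "p = (v, cs)" by fastforce
  have "theta_list A cs @ snd t = snd t' \<longleftrightarrow> cs = [] \<and> snd t = snd t'"
    using theta_tail_inject[of cs "snd t" "[]" "snd t'"] assms tailsD(1) by auto
  then show "comp t (pth (Inl (fst t'), snd t')) p = (if t = t' then vtx (fst t) else (0 :: ('v, 'a, 'k::field) pa)) p"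
    by (auto simp: comp_def p pth_apply vtx_def zero_fun_apply prod_eq_iff)
qed

lemma comp_eqI:
  assumes "in_KQ S x" "in_KQ S y" "starts_at (Inl v) x" "starts_at (Inl v) y"
    and eq: "\<And>t. t \<in> tails \<Longrightarrow> comp t x = comp t y"
  shows "x = y"
proof
  fix q
  show "x q = y q"
  proof (cases "is_path S q \<and> fst q = Inl v")
    case True
    then have "is_path S (Inl v, snd q)" by (metis prod.collapse)
    then obtain cs ts where *: "q = (Inl v, theta_list A cs @ ts)" "(path_end Q (v, cs), ts) \<in> tails"
      using path_cases True by (metis prod.collapse)
    then show ?thesis using fun_cong[OF eq[OF *(2)], of "(v, cs)"] by (simp add: comp_def)
  next
    case False
    then have "x q = 0" "y q = 0" using assms(1-4) unfolding in_KQ_def supp_def starts_at_def by blast+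
    then show ?thesis by simp
  qed
qed

abbreviation tail_pth :: "'v \<times> ('a \<times> nat) list \<Rightarrow> ('v + 'a \<times> nat, 'a \<times> nat, 'k::field) pa" where
  "tail_pth t \<equiv> pth (Inl (fst t), snd t)"

text \<open>Serves to build an element from prescribed components. Composition with the tail keeps
  only the part of \<open>h t\<close> that ends where the tail starts, hence the vertex
  factor.\<close>

lemma comp_tail_sum:
  assumes "t \<in> tails"
  shows "comp t (\<Sum>s\<in>tails. conv S (th (h s)) (tail_pth s)) = conv Q (h t) (vtx (fst t))"
proof -
  have "comp t (\<Sum>s\<in>tails. conv S (th (h s)) (tail_pth s)) =
      (\<Sum>s\<in>tails. if t = s then conv Q (h s) (vtx (fst s)) else 0)"
    unfolding comp_sum by (rule sum.cong) (auto simp: comp_conv_th[OF assms] comp_pth_tail[OF assms])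
  then show ?thesis using assms finite_tails by simp
qed

lemma in_KQ_tail_sum:
  assumes "\<And>t. t \<in> tails \<Longrightarrow> in_KQ Q (h t)"
  shows "in_KQ S (\<Sum>t\<in>tails. conv S (th (h t)) (tail_pth t))"
  using assms by (auto intro!: in_KQ_sum in_KQ_conv[OF wf_S] in_KQ_th tail_path)

lemma starts_at_tail_sum:
  assumes "\<And>t. t \<in> tails \<Longrightarrow> starts_at v (h t)"
  shows "starts_at (Inl v) (\<Sum>t\<in>tails. conv S (th (h t)) (tail_pth t))"
  using assms by (auto intro!: starts_at_sum starts_at_conv starts_at_th)

lemma tail_expansion:
  assumes "in_KQ S y" "starts_at (Inl v) y"
  shows "y = (\<Sum>t\<in>tails. conv S (th (comp t y)) (tail_pth t))"
  by (rule comp_eqI[where v = v])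
    (use assms in \<open>auto simp: comp_tail_sum conv_comp_vtx
      intro!: in_KQ_tail_sum starts_at_tail_sum in_KQ_comp starts_at_comp\<close>)

section \<open>The stretched ideal\<close>

lemma th_ideal:
  fixes x :: "('v, 'a, 'k::field) pa"
  assumes G: "\<forall>x\<in>G. in_KQ Q x" and x: "x \<in> ideal_gen Q G"
  shows "th x \<in> ideal_gen S (th ` G)"
  using x G wf
proof (induction rule: ideal_gen_conv_induct)
  case (gen g p q c)
  then have "th (pth p :: ('v, 'a, 'k) pa) = pth (Inl (fst p), theta_list A (snd p))"
    "th (pth q :: ('v, 'a, 'k) pa) = pth (Inl (fst q), theta_list A (snd q))"
    by (metis prod.collapse th_pth)+
  moreover have "is_path S (Inl (fst p), theta_list A (snd p))"
    "is_path S (Inl (fst q), theta_list A (snd q))"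
    using gen by (auto intro!: is_path_theta)
  ultimately show ?case
    using gen(1) G ideal_gen_gen[of "th g" "th ` G" S "(Inl (fst p), theta_list A (snd p))"
      "(Inl (fst q), theta_list A (snd q))" c]
    by (simp add: th_psmult th_conv in_KQ_th wf_S)
qed (auto simp: th_add intro: ideal_gen_add)

text \<open>In a sandwiched generator the middle factor starts at an old vertex. If the left path
  also starts at an old vertex and meets it, that path is itself stretched, so \<open>comp\<close>
  passes both factors and acts only on the right path. In all other cases the component is
  zero.\<close>

lemma comp_ideal:
  assumes G: "\<forall>x\<in>G. uniform Q x" and y: "y \<in> ideal_gen S (th ` G)" and t: "t \<in> tails"
  shows "comp t y \<in> ideal_gen Q G"
proof -
  have GK: "\<forall>x\<in>G. in_KQ Q x" using G by (simp add: uniform_iff)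
  have "\<forall>x\<in>th ` G. in_KQ S x" using GK by (auto intro: in_KQ_th)
  note ideal = two_sided_ideal_gen[OF GK wf]
  show ?thesis
    using y \<open>\<forall>x\<in>th ` G. in_KQ S x\<close> wf_S
  proof (induction rule: ideal_gen_conv_induct)
    case (gen x p q c)
    then obtain z where z: "z \<in> G" "x = th z" by blast
    then obtain v where v: "starts_at v z" using G by (auto simp: uniform_iff)
    obtain u as where p: "p = (u, as)" by fastforce
    show ?case
    proof (cases "u \<in> range Inl \<and> path_end S p = Inl v")
      case True
      then obtain w cs where "p = (Inl w, theta_list A cs)" and cs: "is_path Q (w, cs)"
        using gen(2) p path_between_old by (metis imageE)
      then have "comp t (conv S (conv S (pth p) x) (pth q)) =
          conv Q (conv Q (pth (w, cs)) z) (comp t (pth q))"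
        using comp_conv_th[OF t, of "conv Q (pth (w, cs)) z"] by (simp add: z th_conv th_pth)
      moreover have "conv Q (conv Q (pth (w, cs)) z) (comp t (pth q)) \<in> ideal_gen Q G"
        using ideal_gen_superset[OF z(1) _ wf] G z(1) cs gen(3) t
        by (intro two_sidedD(5,6)[OF ideal] in_KQ_comp) auto
      ultimately show ?thesis by (simp add: comp_psmult two_sidedD(4)[OF ideal])
    next
      case False
      have "comp t (conv S (conv S (pth p) x) (pth q)) = 0"
      proof (cases "path_end S p = Inl v")
        case True
        with False obtain b where "u = Inr b" by (cases u) auto
        then show ?thesis by (intro comp_starts_at_new[of b] starts_at_conv) (simp add: p)
      next
        case False
        have "conv S (pth p) x = 0"
          unfolding z(2) by (rule conv_eq_zero_mismatch[OF _ starts_at_th[OF v] False]) simp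
        then show ?thesis by simp
      qed
      then show ?thesis by (simp add: comp_psmult)
    qed
  qed (auto simp: comp_add intro: ideal_gen_add)
qed

text \<open>The restriction to an old starting vertex is essential, because \<open>comp\<close>
  ignores paths that start at new vertices. For the converse, \<open>tail_expansion\<close> rebuilds
  \<open>y\<close> from its components inside the ideal.\<close>

lemma mem_stretched_ideal_iff:
  assumes G: "\<forall>x\<in>G. uniform Q x" and y: "in_KQ S y" "starts_at (Inl v) y"
  shows "y \<in> ideal_gen S (th ` G) \<longleftrightarrow> (\<forall>t\<in>tails. comp t y \<in> ideal_gen Q G)"
proof
  assume "\<forall>t\<in>tails. comp t y \<in> ideal_gen Q G"
  have GK: "\<forall>x\<in>G. in_KQ Q x" using G by (simp add: uniform_iff)
  then have "\<forall>x\<in>th ` G. in_KQ S x" by (auto intro: in_KQ_th)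
  note ideal = two_sided_ideal_gen[OF this wf_S]
  have "(\<Sum>t\<in>tails. conv S (th (comp t y)) (tail_pth t)) \<in> ideal_gen S (th ` G)"
    using \<open>\<forall>t\<in>tails. _\<close>
    by (auto intro!: two_sided_sum[OF ideal] two_sidedD(5)[OF ideal] th_ideal[OF GK] tail_path)
  then show "y \<in> ideal_gen S (th ` G)" by (simp flip: tail_expansion[OF y])
qed (use comp_ideal[OF G] in blast)

text \<open>The component of \<open>th x\<close> along the empty tail at the end of \<open>x\<close>
  is \<open>x\<close> itself. This carries the irredundance of the generators over to the stretched
  quiver.\<close>

lemma th_mem_stretched_ideal_iff:
  assumes G: "\<forall>x\<in>G. uniform Q x" and x: "uniform Q x"
  shows "th x \<in> ideal_gen S (th ` G) \<longleftrightarrow> x \<in> ideal_gen Q G"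
proof
  assume th: "th x \<in> ideal_gen S (th ` G)"
  let ?w = "uterm Q x"
  have w: "?w \<in> verts Q" "ends_at Q ?w x" using uterm_props[OF x] by auto
  then have t: "(?w, []) \<in> tails" by (simp add: tails_def)
  have "comp (?w, []) (th x) = x"
    using w(2) by (auto simp: comp_def th_theta_path ends_at_def fun_eq_iff)
  with comp_ideal[OF G th t] show "x \<in> ideal_gen Q G" by simp
next
  assume "x \<in> ideal_gen Q G"
  then show "th x \<in> ideal_gen S (th ` G)" using G by (intro th_ideal) (auto simp: uniform_iff)
qed

end

context stretching
begin

section \<open>Left division and cancellation in the stretched path algebra\<close>

lemma th_trivial:
  assumes "\<And>v. x (v, []) = 0"
  shows "th x (u, []) = 0"
proof (rule ccontr)
  assume "th x (u, []) \<noteq> 0"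
  then obtain v cs where "(u, []) = (Inl v, theta_list A cs)" "x (v, cs) \<noteq> 0"
    by (rule th_nonzeroE)
  then show False using assms by (cases cs) (auto simp: block_Cons)
qed

text \<open>The stretched arrow on which the path begins is completed after at most \<open>A\<close>
  steps. This reduces long paths with a new starting vertex to paths from an old one.\<close>

lemma reach_old_vertex:
  assumes "is_path S (u, as)" "A \<le> length as"
  obtains k v where "k \<le> A" "path_end S (u, take k as) = Inl v"
proof -
  obtain \<alpha> i bs where as: "as = (\<alpha>, i) # bs"
    using assms(2) A_ge_1 by (cases as) auto
  have i: "1 \<le> i" "i \<le> A"
    using assms(1) by (auto simp: as is_path_Cons[OF wf_S] arrs_S)
  have "is_path S (u, take (Suc (A - i)) as @ drop (Suc (A - i)) as)" using assms(1) by simp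
  then have "is_path S (u, take (Suc (A - i)) as)" unfolding is_path_append[OF wf_S] ..
  then have path: "is_path S (u, (\<alpha>, i) # take (A - i) bs)" by (simp add: as)
  have len: "length (take (A - i) bs) = A - i" using assms(2) i by (simp add: as)
  have "take (A - i) bs = map (Pair \<alpha>) [Suc i..<Suc i + (A - i)]"
    using path_walk[OF path] by (simp only: len)
  then have "take (Suc (A - i)) as = map (Pair \<alpha>) [i..<Suc A]"
    using i by (simp add: as upt_conv_Cons)
  then have "path_end S (u, take (Suc (A - i)) as) = Inl (tgt Q \<alpha>)"
    using i by (simp add: path_end_def tgt_S upt_Suc)
  moreover have "Suc (A - i) \<le> A" using i by simp
  ultimately show thesis using that by blast
qed

lemma ldiv_th_new:
  assumes "2 \<le> j"
  shows "ldiv S (\<alpha>, j) (th x) = 0"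
  using assms by (auto simp: ldiv_def pointwise src_S intro!: th_outside)

text \<open>Since \<open>th\<close> sends \<alpha> to a whole block, dividing by its first arrow
  leaves the other A - 1 arrows in front. For A = 1 this factor is the trivial path at the end of
  \<alpha>.\<close>

lemma ldiv_th_old:
  assumes x: "in_KQ Q x" "\<And>v. x (v, []) = 0" and \<alpha>: "\<alpha> \<in> arrs Q"
  shows "ldiv S (\<alpha>, 1) (th x) =
    conv S (pth (tgt S (\<alpha>, 1), map (Pair \<alpha>) [2..<Suc A])) (th (ldiv Q \<alpha> x))"
proof -
  have "th x = (\<Sum>\<beta>\<in>arrs Q. conv S (pth (Inl (src Q \<beta>), (\<beta>, 1) # map (Pair \<beta>) [2..<Suc A])) (th (ldiv Q \<beta> x)))"
    by (subst arrow_expansion[OF wf finA x]) (simp add: th_sum th_conv arr_def th_pth block_Cons)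
  then have "ldiv S (\<alpha>, 1) (th x) = (\<Sum>\<beta>\<in>arrs Q. if \<beta> = \<alpha>
      then conv S (pth (tgt S (\<alpha>, 1), map (Pair \<alpha>) [2..<Suc A])) (th (ldiv Q \<alpha> x)) else 0)"
    by (simp add: ldiv_sum) (rule sum.cong, auto simp: ldiv_conv_pth_Cons src_S)
  then show ?thesis using \<alpha> finA by simp
qed

text \<open>No generator of the stretched ideal starts with an arrow \<open>(\<alpha>, j)\<close>, \<open>j \<ge> 2\<close>, so such an arrow
  can be cancelled on the left.\<close>
lemma stretched_ideal_cancel:
  assumes G: "finite G" "\<forall>x\<in>G. uniform Q x" "\<forall>x\<in>G. \<forall>v. x (v, []) = 0"
    and "is_path S (u, as)" "\<And>a. a \<in> set as \<Longrightarrow> 2 \<le> snd a"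
    and "starts_at (path_end S (u, as)) y" "conv S (pth (u, as)) y \<in> ideal_gen S (th ` G)"
  shows "y \<in> ideal_gen S (th ` G)"
  using assms(4-)
proof (induction as arbitrary: u)
  case Nil
  then show ?case by (simp add: starts_at_iff[of _ _ S] vtx_def)
next
  case (Cons a as)
  obtain \<alpha> j where a: "a = (\<alpha>, j)" by fastforce
  have path: "a \<in> arrs S" "src S a = u" "is_path S (tgt S a, as)"
    using Cons.prems(1) by (auto simp: is_path_Cons[OF wf_S])
  have "ldiv S a (conv S (pth (u, a # as)) y) \<in> ideal_gen S (th ` G)"
  proof -
    have "x (v, []) = 0" if x: "x \<in> th ` G" for x v
    proof -
      obtain z where "z \<in> G" "x = th z" using x by blast
      then show ?thesis using th_trivial[of z v] G(3) by simp
    qed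
    then obtain h where "ldiv S a (conv S (pth (u, a # as)) y) -
        (\<Sum>x\<in>th ` G. conv S (ldiv S a x) (h x)) \<in> ideal_gen S (th ` G)"
      using ideal_gen_ldiv[of S "th ` G", OF wf_S _ _ _ Cons.prems(4)] path(1) G uniform_th
      by blast
    moreover have "(\<Sum>x\<in>th ` G. conv S (ldiv S a x) (h x)) = 0"
      using Cons.prems(2)[of a] by (intro sum.neutral) (auto simp: a ldiv_th_new)
    ultimately show ?thesis by simp
  qed
  then have "conv S (pth (tgt S a, as)) y \<in> ideal_gen S (th ` G)"
    using path(2) by (simp add: ldiv_conv_pth_Cons)
  then show ?case using Cons.IH[of "tgt S a"] Cons.prems path(3) by simp
qed

section \<open>Transfer of decompositions\<close>

definition lift :: "('v, 'a, 'k::field) pa set \<Rightarrow> (('v, 'a, 'k) pa \<Rightarrow> ('v, 'a, 'k) pa) \<Rightarrow>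
    ('v + 'a \<times> nat, 'a \<times> nat, 'k) pa \<Rightarrow> ('v + 'a \<times> nat, 'a \<times> nat, 'k) pa" where
  "lift G r = (\<lambda>z. if z \<in> th ` G then th (r (the_inv_into G th z)) else 0)"

lemma inj_th: "inj_on th G"
  by (simp add: inj_on_def th_inject)

lemma lift_th [simp]: "z \<in> G \<Longrightarrow> lift G r (th z) = th (r z)"
  by (simp add: lift_def the_inv_into_f_f[OF inj_th])

lemma lift_outside: "z \<notin> th ` G \<Longrightarrow> lift G r z = 0"
  by (simp add: lift_def)

lemma decomp_in_th_iff:
  assumes G: "\<forall>z\<in>G. uniform Q z \<and> z \<noteq> 0"
  shows "decomp_in S (th ` G) T x r \<longleftrightarrow> (\<forall>z. z \<notin> th ` G \<longrightarrow> r z = 0) \<and>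
     (\<forall>z\<in>G. in_KQ S (r (th z)) \<and> r (th z) \<in> T \<and> starts_at (Inl (uterm Q z)) (r (th z))) \<and>
     x = (\<Sum>z\<in>G. conv S (th z) (r (th z)))"
proof -
  have "\<forall>z\<in>th ` G. in_KQ S z" using G by (auto simp: uniform_iff intro: in_KQ_th)
  moreover have "\<And>z. z \<in> G \<Longrightarrow> uterm S (th z) = Inl (uterm Q z)" using uterm_th G by blast
  ultimately show ?thesis
    by (subst decomp_in_iff) (simp_all add: sum.reindex inj_th cong: ball_cong)
qed

text \<open>\<open>T\<close> and \<open>T'\<close> stand either for all elements or for I and the
  stretched ideal. Two decompositions of \<open>th x\<close> differ by a relation whose component
  along each tail is a relation over KQ; added to \<open>r\<close>, it gives another decomposition
  of \<open>x\<close>, so it vanishes.\<close>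

lemma decomp_in_lift_iff:
  assumes G: "\<forall>z\<in>G. uniform Q z \<and> z \<noteq> 0"
    and T: "\<And>y. y \<in> T \<Longrightarrow> th y \<in> T'" "\<And>y t. y \<in> T' \<Longrightarrow> t \<in> tails \<Longrightarrow> comp t y \<in> T"
      "\<And>y z. y \<in> T \<Longrightarrow> z \<in> T \<Longrightarrow> y + z \<in> T" "\<And>y z. y \<in> T' \<Longrightarrow> z \<in> T' \<Longrightarrow> y - z \<in> T'"
    and r: "decomp_in Q G T x r" and unique: "\<And>r'. decomp_in Q G T x r' \<Longrightarrow> r' = r"
  shows "decomp_in S (th ` G) T' (th x) r' \<longleftrightarrow> r' = lift G r"
proof -
  have GK: "\<forall>z\<in>G. in_KQ Q z" using G by (simp add: uniform_iff)
  note D = decomp_in_iff[OF GK]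
  have rD: "\<And>z. z \<notin> G \<Longrightarrow> r z = 0" "x = (\<Sum>z\<in>G. conv Q z (r z))"
    "\<And>z. z \<in> G \<Longrightarrow> in_KQ Q (r z)" "\<And>z. z \<in> G \<Longrightarrow> r z \<in> T"
    "\<And>z. z \<in> G \<Longrightarrow> starts_at (uterm Q z) (r z)"
    using r unfolding D by auto
  have th_x: "th x = (\<Sum>z\<in>G. conv S (th z) (th (r z)))"
    by (subst rD(2)) (simp add: th_sum th_conv)
  show ?thesis
  proof
    assume "r' = lift G r"
    then show "decomp_in S (th ` G) T' (th x) r'"
      using rD(3-5) th_x unfolding decomp_in_th_iff[OF G]
      by (auto simp: lift_outside intro: in_KQ_th T(1) starts_at_th)
  next
    assume "decomp_in S (th ` G) T' (th x) r'"
    then have r': "\<And>z. z \<notin> th ` G \<Longrightarrow> r' z = 0" "th x = (\<Sum>z\<in>G. conv S (th z) (r' (th z)))"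
      "\<And>z. z \<in> G \<Longrightarrow> in_KQ S (r' (th z))" "\<And>z. z \<in> G \<Longrightarrow> r' (th z) \<in> T'"
      "\<And>z. z \<in> G \<Longrightarrow> starts_at (Inl (uterm Q z)) (r' (th z))"
      unfolding decomp_in_th_iff[OF G] by auto
    define k where "k = (\<lambda>t z. if z \<in> G then comp t (r' (th z) - th (r z)) else 0)"
    have k_zero: "k t = (\<lambda>_. 0)" if t: "t \<in> tails" for t
    proof -
      have "(\<Sum>z\<in>G. conv Q z (k t z)) =
          comp t ((\<Sum>z\<in>G. conv S (th z) (r' (th z))) - (\<Sum>z\<in>G. conv S (th z) (th (r z))))"
        unfolding sum_subtractf[symmetric] conv_diff_right[symmetric] comp_sum
        by (rule sum.cong) (auto simp: k_def comp_conv_th[OF t])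
      then have "(\<Sum>z\<in>G. conv Q z (k t z)) = 0" by (simp flip: r'(2) th_x)
      then have "x = (\<Sum>z\<in>G. conv Q z (r z + k t z))"
        by (simp add: conv_add_right sum.distrib flip: rD(2))
      then have "decomp_in Q G T x (\<lambda>z. r z + k t z)"
        unfolding D using rD(1,3-5) r' t
        by (auto simp: k_def intro!: in_KQ_add starts_at_add in_KQ_comp in_KQ_diff in_KQ_th
            starts_at_comp starts_at_diff starts_at_th T)
      then have "(\<lambda>z. r z + k t z) = r" by (rule unique)
      then show ?thesis by (metis add_cancel_right_right)
    qed
    have "r' (th z) = th (r z)" if z: "z \<in> G" for z
    proof (rule comp_eqI[where v = "uterm Q z"])
      fix t assume "t \<in> tails"
      then have "k t z = 0" by (simp add: k_zero)
      then show "comp t (r' (th z)) = comp t (th (r z))" using z by (simp add: k_def comp_diff)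
    qed (use z r' rD in \<open>auto intro: in_KQ_th starts_at_th\<close>)
    then have "r' z = lift G r z" for z
      using r'(1) by (cases "z \<in> th ` G") (auto simp: lift_outside)
    then show "r' = lift G r" by (rule ext)
  qed
qed

end

section \<open>The stretched resolution\<close>

locale stretched_resolution = stretching Q A
  for Q :: "('v, 'a) quiver" and A +
  fixes I :: "('v, 'a, 'k::field) pa set" and g :: "nat \<Rightarrow> ('v, 'a, 'k) pa set"
  assumes res: "gives_min_res Q I g"
begin

sublocale base: bound_quiver Q I g
  using wf finV finA res by unfold_locales (auto simp: gives_min_res_def)

abbreviation J :: "('v + 'a \<times> nat, 'a \<times> nat, 'k) pa set" where
  "J \<equiv> ideal_gen S (th ` g 2)"

abbreviation gt :: "nat \<Rightarrow> ('v + 'a \<times> nat, 'a \<times> nat, 'k) pa set" where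
  "gt \<equiv> gtilde Q A g"

lemma gD:
  assumes "1 \<le> n"
  shows "finite (g n)" "x \<in> g n \<Longrightarrow> uniform Q x" "x \<in> g n \<Longrightarrow> x \<noteq> 0" "x \<in> g n \<Longrightarrow> in_KQ Q x"
proof -
  have "finite (g n) \<and> (\<forall>x\<in>g n. uniform Q x \<and> x \<noteq> 0)"
  proof -
    consider "n = 1" | "n = 2" | "3 \<le> n" using assms by linarith
    then show ?thesis
    proof cases
      case 1
      then show ?thesis
        using base.g1 finA wf by (auto simp: arr_def intro!: uniform_pth is_path_arr)
    next
      case 2
      then show ?thesis using base.g2D(1,3) min_gen_setD(1)[OF base.gens] by auto
    next
      case 3
      then show ?thesis using res by (auto simp: gives_min_res_def pzero_eq_zero)
    qed
  qed
  then show "finite (g n)" "x \<in> g n \<Longrightarrow> uniform Q x" "x \<in> g n \<Longrightarrow> x \<noteq> 0" "x \<in> g n \<Longrightarrow> in_KQ Q x"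
    by (auto simp: uniform_iff)
qed

lemma thetastar_image: "1 \<le> n \<Longrightarrow> thetastar A ` g n = th ` g n"
  by (rule image_cong) (auto simp: thetastar_eq_th in_KQ_finite[OF gD(4)])

lemma gt_eq: "2 \<le> n \<Longrightarrow> gt n = th ` g n"
  using thetastar_image[of n] by (simp add: gtilde_def)

lemma g2_uniform: "\<forall>x\<in>g 2. uniform Q x"
  using base.g2D(1) by blast

section \<open>Admissibility and minimal generation of the stretched ideal\<close>

lemma ideal_J: "two_sided S J"
  by (rule two_sided_ideal_gen[OF _ wf_S]) (use base.g2D(2) in_KQ_th in auto)

lemma J_iff:
  assumes "in_KQ S y" "starts_at (Inl v) y"
  shows "y \<in> J \<longleftrightarrow> (\<forall>t\<in>tails. comp t y \<in> I)"
  using mem_stretched_ideal_iff[OF g2_uniform assms] by (simp add: base.I_eq)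

lemma comp_J: "y \<in> J \<Longrightarrow> t \<in> tails \<Longrightarrow> comp t y \<in> I"
  using comp_ideal[OF g2_uniform] by (simp add: base.I_eq)

lemma th_J: "x \<in> I \<Longrightarrow> th x \<in> J"
  using th_ideal[of "g 2"] base.g2D(2) by (simp add: base.I_eq)

text \<open>Of the \<open>Suc m * A\<close> arrows at most \<open>A\<close> lead to the first old
  vertex. The remaining ones, at least \<open>m * A\<close>, are full blocks followed by a tail
  shorter than \<open>A\<close>, hence contain at least \<open>m\<close> full blocks, and these come
  from a path of Q in I.\<close>

lemma long_path_in_J:
  assumes m: "\<And>p. is_path Q p \<Longrightarrow> m \<le> length (snd p) \<Longrightarrow> pth p \<in> I"
    and p: "is_path S p" "Suc m * A \<le> length (snd p)"
  shows "pth p \<in> J"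
proof -
  obtain u as where pu: "p = (u, as)" by fastforce
  obtain k v where k: "k \<le> A" "path_end S (u, take k as) = Inl v"
    using reach_old_vertex[of u as] p pu by auto
  have "is_path S (u, take k as @ drop k as)" using p by (simp add: pu)
  then have paths: "is_path S (u, take k as)" "is_path S (Inl v, drop k as)"
    unfolding is_path_append[OF wf_S] k(2) by auto
  obtain cs ts where cs: "drop k as = theta_list A cs @ ts" "is_path Q (v, cs)"
    "(path_end Q (v, cs), ts) \<in> tails"
    using path_cases[OF paths(2)] by blast
  have "m * A \<le> length (drop k as)" using p(2) k(1) by (simp add: pu)
  then have "m * A < A * Suc (length cs)"
    using tailsD(1)[OF cs(3)] unfolding cs(1) by simp
  then have "A * m < A * Suc (length cs)" by (simp only: mult.commute)
  then have "m \<le> length cs" unfolding mult_less_cancel1 by simp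
  then have "pth (Inl v, theta_list A cs) \<in> J"
    using th_J[OF m[OF cs(2)]] by (simp add: th_pth)
  moreover have "pth p = conv S (conv S (pth (u, take k as)) (pth (Inl v, theta_list A cs)))
      (pth (Inl (path_end Q (v, cs)), ts) :: ('v + 'a \<times> nat, 'a \<times> nat, 'k) pa)"
    using k(2) cs(1) append_take_drop_id[of k as]
    by (simp add: conv_pth_pth path_end_append path_end_theta pu)
  ultimately show ?thesis
    using paths(1) tail_path[OF cs(3)]
    by (simp add: two_sidedD(5)[OF ideal_J] two_sidedD(6)[OF ideal_J])
qed

text \<open>Every path in a sandwiched generator contains a stretched path of an element of
  \<open>g 2\<close>, which has at least \<open>2 * A\<close> arrows.\<close>

lemma J_length:
  assumes "x \<in> J" "x p \<noteq> 0"
  shows "2 \<le> length (snd p)"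
proof -
  have "\<forall>x\<in>th ` g 2. in_KQ S x" using base.g2D(2) in_KQ_th by auto
  with assms(1) have "\<forall>p. x p \<noteq> 0 \<longrightarrow> 2 \<le> length (snd p)"
    using wf_S
  proof (induction rule: ideal_gen_conv_induct)
    case zero
    then show ?case by (simp add: zero_fun_apply)
  next
    case (add x y)
    then show ?case unfolding plus_fun_apply by (metis add_0)
  next
    case (gen y p q c)
    then obtain z where z: "z \<in> g 2" "y = th z" by blast
    show ?case
    proof (intro allI impI)
      fix r assume "psmult c (conv S (conv S (pth p) y) (pth q)) r \<noteq> 0"
      then have "r \<in> supp (conv S (conv S (pth p) y) (pth q))"
        by (simp add: supp_def psmult_apply)
      then obtain u as bs where r: "r = (u, as @ bs)" "(u, as) \<in> supp (conv S (pth p) y)"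
        by (rule supp_convE)
      from r(2) obtain ds es w where "as = ds @ es" "(w, es) \<in> supp y"
        by (rule supp_convE) auto
      then obtain v cs where cs: "as = ds @ theta_list A cs" "z (v, cs) \<noteq> 0"
        unfolding z(2) by (auto simp: supp_def elim!: th_nonzeroE)
      have "2 \<le> length cs"
        using base.adm base.g2D(4)[OF z(1)] cs(2) by (fastforce simp: admissible_iff supp_def)
      then have "2 * 1 \<le> length cs * A" using A_ge_1 by (rule mult_le_mono)
      then show "2 \<le> length (snd r)" by (simp add: r cs mult.commute)
    qed
  qed
  with assms(2) show ?thesis by blast
qed

lemma admissible_J: "admissible S J"
proof -
  obtain m where m: "2 \<le> m" "\<And>p. is_path Q p \<Longrightarrow> m \<le> length (snd p) \<Longrightarrow> pth p \<in> I"
    using base.adm by (auto simp: admissible_iff)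
  have "2 * 1 \<le> Suc m * A" using m(1) A_ge_1 by (intro mult_le_mono) auto
  then have "\<exists>m\<ge>2. \<forall>p. is_path S p \<longrightarrow> m \<le> length (snd p) \<longrightarrow> pth p \<in> J"
    using long_path_in_J[OF m(2)] by (intro exI[of _ "Suc m * A"]) simp
  with ideal_J J_length show ?thesis by (auto simp: admissible_iff supp_def)
qed

lemma min_gen_set_J: "min_gen_set S J (gt 2)"
proof -
  have "x \<notin> ideal_gen S (th ` g 2 - {x})" if x: "x \<in> th ` g 2" for x
  proof -
    obtain z where z: "z \<in> g 2" "x = th z" using x by blast
    have "th ` g 2 - {x} = th ` (g 2 - {z})" by (auto simp: z th_inject)
    then show ?thesis
      using th_mem_stretched_ideal_iff[of "g 2 - {z}" z] g2_uniform z
        min_gen_setD(5)[OF base.gens] by auto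
  qed
  moreover have "uniform S x \<and> x \<noteq> 0" if x: "x \<in> th ` g 2" for x
    using x base.g2D(1,3) uniform_th by auto
  ultimately show ?thesis
    using min_gen_setD(1)[OF base.gens]
    unfolding min_gen_set_def pzero_eq_zero gt_eq[OF order_refl] by auto
qed

lemma bound_quiver_S: "bound_quiver S J gt"
proof (rule bound_quiver.intro)
  show "gt 0 = vtx ` verts S" "gt 1 = arr S ` arrs S" by (simp_all add: gtilde_def)
  show "wf_quiver S" "finite (verts S)" "finite (arrs S)"
    by (rule wf_S finite_verts_S finite_arrs_S)+
  show "admissible S J" by (rule admissible_J)
  show "min_gen_set S J (gt 2)" by (rule min_gen_set_J)
qed

lemmas
  stretched_g0 = bound_quiver.g0[OF bound_quiver_S]  and
  stretched_g1 = bound_quiver.g1[OF bound_quiver_S]  and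
  stretched_dmap2 = bound_quiver.dmap2[OF bound_quiver_S]  and
  stretched_dzero_surj = bound_quiver.dzero_surj[OF bound_quiver_S]  and
  stretched_exact0 = bound_quiver.exact0[OF bound_quiver_S]  and
  stretched_exact1 = bound_quiver.exact1[OF bound_quiver_S]  and
  stretched_minimal1 = bound_quiver.minimal1[OF bound_quiver_S]  and
  stretched_minimal2 = bound_quiver.minimal2[OF bound_quiver_S]

section \<open>Coefficients of the differentials\<close>

lemma ex1_decomp:
  assumes "3 \<le> n" "x \<in> g n"
  shows "\<exists>!r. decomp_in Q (g (n - 1)) UNIV x r" "\<exists>!s. decomp_in Q (g (n - 2)) I x s"
proof -
  have "\<forall>n\<ge>3. finite (g n) \<and> (\<forall>x\<in>g n. uniform Q x \<and> x \<noteq> pzero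
      \<and> (\<exists>!r. decomp_in Q (g (n - 1)) UNIV x r) \<and> (\<exists>!s. decomp_in Q (g (n - 2)) I x s))"
    using res unfolding gives_min_res_def by (elim conjE)
  from this[rule_format, OF assms(1)] assms(2)
  show "\<exists>!r. decomp_in Q (g (n - 1)) UNIV x r" "\<exists>!s. decomp_in Q (g (n - 2)) I x s"
    by blast+
qed

lemma coef_decomp:
  assumes "3 \<le> n" "x \<in> g n"
  shows "decomp_in Q (g (n - 1)) UNIV x (coef Q g n x)"
  by (rule decomp_in_coef) (rule ex1_decomp[OF assms])

lemma decomp_gt_iff:
  assumes "3 \<le> n" "x \<in> g n"
  shows "decomp_in S (gt (n - 1)) UNIV (th x) r \<longleftrightarrow> r = lift (g (n - 1)) (coef Q g n x)"
proof -
  have "2 \<le> n - 1" "1 \<le> n - 1" using assms(1) by auto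
  then show ?thesis
    unfolding gt_eq[OF \<open>2 \<le> n - 1\<close>]
    using coef_decomp[OF assms] ex1_decomp(1)[OF assms] gD(2,3)[OF \<open>1 \<le> n - 1\<close>]
    by (intro decomp_in_lift_iff[where T = UNIV]) blast+
qed

lemma coef_gt: "3 \<le> n \<Longrightarrow> x \<in> g n \<Longrightarrow> coef S gt n (th x) = lift (g (n - 1)) (coef Q g n x)"
  by (rule coef_eq) (rule decomp_gt_iff)

lemma coef_props:
  assumes "2 \<le> n" "x \<in> g n" "z \<in> g (n - 1)"
  shows "in_KQ Q (coef Q g n x z)" "starts_at (uterm Q z) (coef Q g n x z)"
proof -
  have "in_KQ Q (coef Q g n x z) \<and> starts_at (uterm Q z) (coef Q g n x z)"
  proof (cases "n = 2")
    case True
    then obtain \<alpha> where "\<alpha> \<in> arrs Q" "z = arr Q \<alpha>"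
      using assms(3) base.g1 by (auto simp flip: One_nat_def)
    then show ?thesis
      using assms(2) True wf by (simp add: base.coef2 in_KQ_ldiv base.g2D uterm_arr)
  next
    case False
    then have "3 \<le> n" using assms(1) by simp
    have GK: "\<forall>z\<in>g (n - 1). in_KQ Q z" using gD(4)[of "n - 1"] assms(1) by simp
    show ?thesis using coef_decomp[OF \<open>3 \<le> n\<close> assms(2)] assms(3) unfolding decomp_in_iff[OF GK] by blast
  qed
  then show "in_KQ Q (coef Q g n x z)" "starts_at (uterm Q z) (coef Q g n x z)" by auto
qed

lemma inP_gt_iff:
  assumes "2 \<le> n"
  shows "inP S gt n f \<longleftrightarrow> (\<forall>x. x \<notin> th ` g n \<longrightarrow> f x = 0) \<and>
    (\<forall>x\<in>g n. in_KQ S (f (th x)) \<and> starts_at (Inl (uterm Q x)) (f (th x)))"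
  using uterm_th[OF gD(2,3)[of n]] assms by (auto simp: inP_iff gt_eq)

lemma dmap_g:
  assumes "2 \<le> n" "inP Q g n f" "z \<in> g (n - 1)"
  shows "dmap Q g n f z = (\<Sum>x\<in>g n. conv Q (coef Q g n x z) (f x))"
  by (rule dmap_eq_conv) (use assms coef_props in auto)

definition tail_part :: "nat \<Rightarrow> 'v \<times> ('a \<times> nat) list \<Rightarrow>
    (('v + 'a \<times> nat, 'a \<times> nat, 'k) pa \<Rightarrow> ('v + 'a \<times> nat, 'a \<times> nat, 'k) pa) \<Rightarrow>
    ('v, 'a, 'k) pa \<Rightarrow> ('v, 'a, 'k) pa" where
  "tail_part n t f = (\<lambda>x. if x \<in> g n then comp t (f (th x)) else 0)"

lemma inP_tail_part: "2 \<le> n \<Longrightarrow> inP S gt n f \<Longrightarrow> t \<in> tails \<Longrightarrow> inP Q g n (tail_part n t f)"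
  unfolding inP_gt_iff inP_iff[of Q] by (auto simp: tail_part_def intro: in_KQ_comp starts_at_comp)

text \<open>The stretched differential in the coordinates \<open>g (n - 1)\<close>. For n \<ge> 3 it
  is the true one (\<open>dmap_gt\<close>); for n = 2 it treats each stretched arrow as one
  generator, and the true differential has the rest of the block in front
  (\<open>dmap_gt2_old\<close>).\<close>

definition dsum :: "nat \<Rightarrow> (('v + 'a \<times> nat, 'a \<times> nat, 'k) pa \<Rightarrow> ('v + 'a \<times> nat, 'a \<times> nat, 'k) pa) \<Rightarrow>
    ('v, 'a, 'k) pa \<Rightarrow> ('v + 'a \<times> nat, 'a \<times> nat, 'k) pa" where
  "dsum n f z = (\<Sum>x\<in>g n. conv S (th (coef Q g n x z)) (f (th x)))"

lemma dsum_props: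
  assumes "2 \<le> n" "inP S gt n f" "z \<in> g (n - 1)"
  shows "in_KQ S (dsum n f z)" "starts_at (Inl (uterm Q z)) (dsum n f z)"
  using assms coef_props[OF assms(1) _ assms(3)] unfolding dsum_def inP_gt_iff[OF assms(1)]
  by (auto intro!: in_KQ_sum in_KQ_conv[OF wf_S] in_KQ_th starts_at_sum starts_at_conv starts_at_th)

lemma comp_dsum:
  assumes "2 \<le> n" "inP S gt n f" "z \<in> g (n - 1)" "t \<in> tails"
  shows "comp t (dsum n f z) = dmap Q g n (tail_part n t f) z"
  unfolding dmap_g[OF assms(1) inP_tail_part[OF assms(1,2,4)] assms(3)] dsum_def comp_sum
  by (rule sum.cong) (auto simp: comp_conv_th[OF assms(4)] tail_part_def)

lemma dsum_in_J_iff: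
  assumes "2 \<le> n" "inP S gt n f" "z \<in> g (n - 1)"
  shows "dsum n f z \<in> J \<longleftrightarrow> (\<forall>t\<in>tails. dmap Q g n (tail_part n t f) z \<in> I)"
  using J_iff[OF dsum_props[OF assms]] comp_dsum[OF assms] by simp

lemma dmap_gt:
  assumes "3 \<le> n" "inP S gt n f" "z \<in> g (n - 1)"
  shows "dmap S gt n f (th z) = dsum n f z"
proof -
  have n: "2 \<le> n" "2 \<le> n - 1" using assms(1) by auto
  have coef: "coef S gt n (th x) (th z) = th (coef Q g n x z)" if "x \<in> g n" for x
    using that assms by (simp add: coef_gt)
  have "dmap S gt n f (th z) = (\<Sum>x\<in>gt n. conv S (coef S gt n x (th z)) (f x))"
    by (rule dmap_eq_conv)
      (use assms n coef coef_props in \<open>auto simp: gt_eq intro!: in_KQ_th\<close>)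
  also have "\<dots> = dsum n f z"
    unfolding dsum_def gt_eq[OF n(1)] sum.reindex[OF inj_th] by (rule sum.cong) (auto simp: coef)
  finally show ?thesis .
qed

lemma dmap_gt2_old:
  assumes "inP S gt 2 f" "\<alpha> \<in> arrs Q"
  shows "dmap S gt 2 f (arr S (\<alpha>, 1)) =
    conv S (pth (tgt S (\<alpha>, 1), map (Pair \<alpha>) [2..<Suc A])) (dsum 2 f (arr Q \<alpha>))"
proof -
  have "(\<alpha>, 1) \<in> arrs S" using assms(2) A_ge_1 by (simp add: arrs_S)
  then have "dmap S gt 2 f (arr S (\<alpha>, 1)) = (\<Sum>x\<in>g 2. conv S (ldiv S (\<alpha>, 1) (th x)) (f (th x)))"
    by (simp add: stretched_dmap2[OF assms(1)] gt_eq sum.reindex inj_th)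
  also have "\<dots> = (\<Sum>x\<in>g 2. conv S (pth (tgt S (\<alpha>, 1), map (Pair \<alpha>) [2..<Suc A]))
      (conv S (th (coef Q g 2 x (arr Q \<alpha>))) (f (th x))))"
    by (rule sum.cong)
      (auto simp: ldiv_th_old base.g2D assms(2) base.coef2 conv_assoc)
  finally show ?thesis by (simp add: dsum_def conv_sum_right)
qed

lemma dmap_gt2_new:
  assumes "inP S gt 2 f" "(\<alpha>, j) \<in> arrs S" "2 \<le> j"
  shows "dmap S gt 2 f (arr S (\<alpha>, j)) = 0"
  unfolding stretched_dmap2[OF assms(1,2)] gt_eq[OF order_refl]
  using assms(3) by (intro sum.neutral) (auto simp: ldiv_th_new)

lemma cancel_block:
  assumes "\<alpha> \<in> arrs Q" "in_KQ S y" "starts_at (Inl (tgt Q \<alpha>)) y"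
  shows "conv S (pth (tgt S (\<alpha>, 1), map (Pair \<alpha>) [2..<Suc A])) y \<in> J \<longleftrightarrow> y \<in> J"
proof -
  have "is_path S (Inl (src Q \<alpha>), block A \<alpha>)" "path_end S (Inl (src Q \<alpha>), block A \<alpha>) = Inl (tgt Q \<alpha>)"
    using block_path[OF assms(1)] path_end_block by auto
  then have path: "is_path S (tgt S (\<alpha>, 1), map (Pair \<alpha>) [2..<Suc A])"
    "path_end S (tgt S (\<alpha>, 1), map (Pair \<alpha>) [2..<Suc A]) = Inl (tgt Q \<alpha>)"
    by (auto simp: block_Cons is_path_Cons[OF wf_S])
  show ?thesis
  proof
    assume "conv S (pth (tgt S (\<alpha>, 1), map (Pair \<alpha>) [2..<Suc A])) y \<in> J"
    from min_gen_setD(1)[OF base.gens] g2_uniform _ path(1) _ _ this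
    show "y \<in> J"
      by (rule stretched_ideal_cancel) (use path(2) assms(3) base.g2D(5) in auto)
  next
    assume "y \<in> J"
    then show "conv S (pth (tgt S (\<alpha>, 1), map (Pair \<alpha>) [2..<Suc A])) y \<in> J"
      using path(1) by (intro two_sidedD(6)[OF ideal_J]) simp_all
  qed
qed

text \<open>In degree 2 the target is indexed by the arrows of the stretched quiver, not by
  \<open>g 1\<close>. The entries at arrows of index at least 2 are zero, and in those of index 1
  the rest of the block is cancelled by \<open>cancel_block\<close>.\<close>

lemma dmap_in_J_iff:
  assumes n: "2 \<le> n" and f: "inP S gt n f"
  shows "(\<forall>z. dmap S gt n f z \<in> J) \<longleftrightarrow> (\<forall>z\<in>g (n - 1). dsum n f z \<in> J)"
proof (cases "n = 2")
  case True
  have f2: "inP S gt 2 f" using f True by simp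
  have key: "dmap S gt 2 f (arr S (\<alpha>, 1)) \<in> J \<longleftrightarrow> dsum 2 f (arr Q \<alpha>) \<in> J" if "\<alpha> \<in> arrs Q" for \<alpha>
  proof -
    have z: "arr Q \<alpha> \<in> g (2 - 1)" using that base.g1 by (simp flip: One_nat_def)
    show ?thesis
      unfolding dmap_gt2_old[OF f2 that]
      using cancel_block[OF that dsum_props(1)[OF _ f2 z]] dsum_props(2)[OF _ f2 z]
        uterm_arr[OF wf that, where ?'k = 'k] by simp
  qed
  have zero: "dmap S gt 2 f z \<in> J" if "z \<notin> (\<lambda>\<alpha>. arr S (\<alpha>, 1)) ` arrs Q" for z
  proof (cases "z \<in> gt 1")
    case True
    then obtain \<alpha> j where z: "z = arr S (\<alpha>, j)" "(\<alpha>, j) \<in> arrs S" by (auto simp: stretched_g1)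
    with that have "2 \<le> j" by (cases "j = 1") (auto simp: arrs_S)
    then show ?thesis using dmap_gt2_new[OF f2 z(2)] by (simp add: z(1))
  next
    case False
    then show ?thesis using dmap_outside[of z gt 2] by (simp flip: One_nat_def)
  qed
  have "(\<forall>z. dmap S gt 2 f z \<in> J) \<longleftrightarrow> (\<forall>\<alpha>\<in>arrs Q. dmap S gt 2 f (arr S (\<alpha>, 1)) \<in> J)"
  proof (intro iffI allI)
    fix z assume old: "\<forall>\<alpha>\<in>arrs Q. dmap S gt 2 f (arr S (\<alpha>, 1)) \<in> J"
    show "dmap S gt 2 f z \<in> J"
    proof (cases "z \<in> (\<lambda>\<alpha>. arr S (\<alpha>, 1)) ` arrs Q")
      case True
      then obtain \<alpha> where "\<alpha> \<in> arrs Q" "z = arr S (\<alpha>, 1)" by (rule imageE)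
      then show ?thesis using old by simp
    qed (rule zero)
  qed simp
  also have "\<dots> \<longleftrightarrow> (\<forall>z\<in>g 1. dsum 2 f z \<in> J)" using key by (simp add: base.g1)
  finally show ?thesis using True by (simp flip: One_nat_def)
next
  case False
  then have n3: "3 \<le> n" "2 \<le> n - 1" using n by auto
  have "dmap S gt n f z \<in> J" if "z \<notin> th ` g (n - 1)" for z
    using that dmap_outside[of z gt n] by (simp add: gt_eq[OF n3(2)])
  then have "(\<forall>z. dmap S gt n f z \<in> J) \<longleftrightarrow> (\<forall>z\<in>g (n - 1). dmap S gt n f (th z) \<in> J)"
    by (metis imageE)
  then show ?thesis using dmap_gt[OF n3(1) f] by simp
qed

section \<open>Exactness in degrees at least two\<close>

lemma exact_g:
  assumes "1 \<le> n" "inP Q g n f"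
  shows "(\<forall>z. dmap Q g n f z \<in> I) \<longleftrightarrow>
    (\<exists>h. inP Q g (Suc n) h \<and> (\<forall>x. f x - dmap Q g (Suc n) h x \<in> I))"
proof -
  have "\<forall>n\<ge>1. \<forall>f. inP Q g n f \<longrightarrow> ((\<forall>z. dmap Q g n f z \<in> I) \<longleftrightarrow>
      (\<exists>h. inP Q g (Suc n) h \<and> (\<forall>x. psub (f x) (dmap Q g (Suc n) h x) \<in> I)))"
    using res unfolding gives_min_res_def by (elim conjE)
  from this[rule_format, OF assms] show ?thesis by (simp only: psub_eq_minus)
qed

text \<open>A cycle splits into one cycle over Q for each tail, and preimages chosen tail by tail
  are glued. Boundaries come from degree at least 3, where the differential is \<open>dsum\<close>;
  only the cycle condition meets the exceptional degree 2.\<close>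

lemma exact_gt:
  assumes n: "2 \<le> n" and f: "inP S gt n f"
  shows "(\<forall>z. dmap S gt n f z \<in> J) \<longleftrightarrow>
    (\<exists>h. inP S gt (Suc n) h \<and> (\<forall>x. f x - dmap S gt (Suc n) h x \<in> J))"
proof -
  have n': "3 \<le> Suc n" "2 \<le> Suc n" "1 \<le> n" using n by auto
  have split: "(\<forall>z. dmap S gt n f z \<in> J) \<longleftrightarrow>
      (\<forall>t\<in>tails. \<forall>z. dmap Q g n (tail_part n t f) z \<in> I)"
  proof -
    have "dmap Q g n h z \<in> I" if "z \<notin> g (n - 1)" for h z
      using that dmap_outside[of z g n] two_sidedD(2)[OF base.ideal] by simp
    then show ?thesis
      using dsum_in_J_iff[OF n f] unfolding dmap_in_J_iff[OF n f] by blast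
  qed
  have comp_f: "comp t (f (th x) - dmap S gt (Suc n) h (th x)) =
      tail_part n t f x - dmap Q g (Suc n) (tail_part (Suc n) t h) x"
    if "inP S gt (Suc n) h" "x \<in> g n" "t \<in> tails" for t h x
    using dmap_gt[OF n'(1) that(1), of x] comp_dsum[OF n'(2) that(1), of x t] that(2,3)
    by (simp add: comp_diff tail_part_def)
  show ?thesis
  proof
    assume "\<forall>z. dmap S gt n f z \<in> J"
    then have "\<forall>t\<in>tails. \<exists>h. inP Q g (Suc n) h \<and>
        (\<forall>x. tail_part n t f x - dmap Q g (Suc n) h x \<in> I)"
      unfolding split using exact_g[OF n'(3) inP_tail_part[OF n f]] by blast
    then obtain k where k: "\<And>t. t \<in> tails \<Longrightarrow> inP Q g (Suc n) (k t)"
      "\<And>t x. t \<in> tails \<Longrightarrow> tail_part n t f x - dmap Q g (Suc n) (k t) x \<in> I"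
      by metis
    \<comment> \<open>Each chosen preimage \<open>k t\<close> is continued along its tail, and
      finiteness of \<open>tails\<close> allows the sum.\<close>
    define h where "h = (\<lambda>y. if y \<in> th ` g (Suc n)
      then \<Sum>t\<in>tails. conv S (th (k t (the_inv_into (g (Suc n)) th y))) (tail_pth t) else 0)"
    have h_th: "h (th y) = (\<Sum>t\<in>tails. conv S (th (k t y)) (tail_pth t))" if "y \<in> g (Suc n)" for y
      using that by (simp add: h_def the_inv_into_f_f[OF inj_th])
    have h: "inP S gt (Suc n) h"
    proof -
      have "in_KQ S (h (th y)) \<and> starts_at (Inl (uterm Q y)) (h (th y))" if y: "y \<in> g (Suc n)" for y
        unfolding h_th[OF y] using k(1) y
        by (auto simp: inP_iff intro!: in_KQ_tail_sum starts_at_tail_sum)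
      then show ?thesis unfolding inP_gt_iff[OF n'(2)] by (simp add: h_def)
    qed
    have "f x - dmap S gt (Suc n) h x \<in> J" for x
    proof (cases "x \<in> th ` g n")
      case True
      then obtain z where z: "z \<in> g n" "x = th z" by blast
      have fz: "in_KQ S (f (th z))" "starts_at (Inl (uterm Q z)) (f (th z))"
        using f z(1) unfolding inP_gt_iff[OF n] by auto
      have dz: "dmap S gt (Suc n) h (th z) = dsum (Suc n) h z"
        using dmap_gt[OF n'(1) h] z(1) by simp
      have "comp t (f (th z) - dmap S gt (Suc n) h (th z)) \<in> I" if t: "t \<in> tails" for t
      proof -
        \<comment> \<open>Gluing truncates \<open>k t\<close> to paths ending where the tail starts.
          The differential multiplies from the left, so it commutes with this truncation;
          \<open>tail_part n t f\<close> is unaffected by it, and I is stable under it.\<close>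
        have "tail_part (Suc n) t h y = conv Q (k t y) (vtx (fst t))" if "y \<in> g (Suc n)" for y
          using that by (simp add: tail_part_def h_th comp_tail_sum[OF t])
        then have "dmap Q g (Suc n) (tail_part (Suc n) t h) z =
            conv Q (dmap Q g (Suc n) (k t) z) (vtx (fst t))"
          using z(1) unfolding dmap_g[OF n'(2) inP_tail_part[OF n'(2) h t], of z, simplified]
            dmap_g[OF n'(2) k(1)[OF t], of z, simplified]
          by (simp add: dmap_g[OF n'(2)] inP_tail_part[OF n'(2) h t] k(1)[OF t]
              conv_sum_left conv_assoc)
        then have "comp t (f (th z) - dmap S gt (Suc n) h (th z)) =
            conv Q (tail_part n t f z - dmap Q g (Suc n) (k t) z) (vtx (fst t))"
          using z(1) by (simp add: comp_f[OF h _ t] conv_diff_left) (simp add: tail_part_def conv_comp_vtx)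
        then show ?thesis
          using k(2)[OF t] tailsD(3)[OF t] by (simp add: two_sidedD(5)[OF base.ideal])
      qed
      then show ?thesis
        unfolding z(2) using fz dz dsum_props[OF n'(2) h, of z] z(1)
        by (subst J_iff[of _ "uterm Q z"]) (auto intro: in_KQ_diff starts_at_diff)
    next
      case False
      then have "f x = 0" using f unfolding inP_gt_iff[OF n] by blast
      then show ?thesis using False dmap_outside[of x gt "Suc n"] by (simp add: gt_eq[OF n])
    qed
    with h show "\<exists>h. inP S gt (Suc n) h \<and> (\<forall>x. f x - dmap S gt (Suc n) h x \<in> J)" by blast
  next
    assume "\<exists>h. inP S gt (Suc n) h \<and> (\<forall>x. f x - dmap S gt (Suc n) h x \<in> J)"
    then obtain h where h: "inP S gt (Suc n) h" "\<And>x. f x - dmap S gt (Suc n) h x \<in> J" by blast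
    have "tail_part n t f x - dmap Q g (Suc n) (tail_part (Suc n) t h) x \<in> I"
      if t: "t \<in> tails" for t x
    proof (cases "x \<in> g n")
      case True
      then show ?thesis using comp_J[OF h(2)[of "th x"] t] comp_f[OF h(1) _ t] by simp
    next
      case False
      then show ?thesis
        using dmap_outside[of x g "Suc n"] two_sidedD(2)[OF base.ideal] by (simp add: tail_part_def)
    qed
    then show "\<forall>z. dmap S gt n f z \<in> J"
      unfolding split using exact_g[OF n'(3) inP_tail_part[OF n f]] inP_tail_part[OF n'(2) h(1)]
      by blast
  qed
qed

section \<open>Minimality and unique decompositions\<close>

lemma minimal_gt:
  assumes "3 \<le> n" "x \<in> g n" "z \<in> g (n - 1)"
  shows "coef S gt n (th x) (th z) (v, []) = 0"
proof -
  have "coef Q g n x z (w, []) = 0" for w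
  proof -
    have "\<forall>n\<ge>1. \<forall>x\<in>g n. \<forall>z\<in>g (n - 1). \<forall>v. coef Q g n x z (v, []) = 0"
      using res unfolding gives_min_res_def by (elim conjE)
    moreover have "1 \<le> n" using assms(1) by simp
    ultimately show ?thesis using assms(2,3) by blast
  qed
  then have "th (coef Q g n x z) (v, []) = 0"
    by (rule th_trivial)
  then show ?thesis using assms by (simp add: coef_gt)
qed

text \<open>For n = 3 the decomposition is over the arrows of the stretched quiver, in general not
  images under \<open>th\<close>, so \<open>decomp_in_lift_iff\<close> does not apply. The
  coefficients are then forced to be left quotients, and it remains to see that these lie in
  \<open>J\<close>.\<close>

lemma ex1_decomp_J:
  assumes n: "3 \<le> n" and x: "x \<in> g n"
  shows "\<exists>!s. decomp_in S (gt (n - 2)) J (th x) s"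
proof (cases "n = 3")
  case True
  obtain s where s: "decomp_in Q (arr Q ` arrs Q) I x s"
    using ex1_decomp(2)[OF assms] base.g1 True by (auto simp flip: One_nat_def)
  have xK: "in_KQ Q x" using gD(4)[of n x] n x by simp
  \<comment> \<open>The given decomposition over the arrows of Q excludes trivial paths: every
    summand begins with an arrow.\<close>
  have x0: "x (v, []) = 0" for v
  proof -
    have "x = (\<Sum>z\<in>arr Q ` arrs Q. conv Q z (s z))"
      using s wf by (subst (asm) decomp_in_iff) (auto simp: in_KQ_arr)
    then have "x = (\<Sum>\<alpha>\<in>arrs Q. conv Q (arr Q \<alpha>) (s (arr Q \<alpha>)))"
      by (simp add: sum.reindex base.inj_arr)
    then show ?thesis by (simp add: sum_fun_apply conv_arr)
  qed
  have div: "ldiv Q \<alpha> x \<in> I" if "\<alpha> \<in> arrs Q" for \<alpha>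
    using s that unfolding decomp_in_arrows_iff[OF wf finA xK x0] by blast
  have "ldiv S a (th x) \<in> J" if "a \<in> arrs S" for a
  proof -
    obtain \<alpha> j where a: "a = (\<alpha>, j)" by fastforce
    with that have \<alpha>: "\<alpha> \<in> arrs Q" "1 \<le> j" by (auto simp: arrs_S)
    show ?thesis
    proof (cases "j = 1")
      case True
      show ?thesis
        unfolding a True ldiv_th_old[OF xK x0 \<alpha>(1)]
        using cancel_block[OF \<alpha>(1), of "th (ldiv Q \<alpha> x)"] th_J[OF div[OF \<alpha>(1)]] wf xK
        by (simp add: in_KQ_th in_KQ_ldiv starts_at_th)
    next
      case False
      then show ?thesis using \<alpha>(2) by (simp add: a ldiv_th_new)
    qed
  qed
  moreover have "th x (v, []) = 0" for v
    using x0 by (rule th_trivial)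
  ultimately have "decomp_in S (arr S ` arrs S) J (th x) r \<longleftrightarrow>
      r = (\<lambda>z. if z \<in> arr S ` arrs S then ldiv S (the_inv_into (arrs S) (arr S) z) (th x) else 0)" for r
    by (subst decomp_in_arrows_iff[OF wf_S finite_arrs_S in_KQ_th[OF xK]]) auto
  then show ?thesis using True stretched_g1 by (simp flip: One_nat_def)
next
  case False
  then have n4: "2 \<le> n - 2" "1 \<le> n - 2" using n by auto
  obtain s where s: "decomp_in Q (g (n - 2)) I x s" "\<And>s'. decomp_in Q (g (n - 2)) I x s' \<Longrightarrow> s' = s"
    using ex1_decomp(2)[OF assms] by blast
  have "decomp_in S (th ` g (n - 2)) J (th x) r \<longleftrightarrow> r = lift (g (n - 2)) s" for r
  proof (rule decomp_in_lift_iff[where T = I])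
    show "\<forall>z\<in>g (n - 2). uniform Q z \<and> z \<noteq> 0" using gD(2,3)[OF n4(2)] by blast
  qed (fact s th_J | erule comp_J two_sidedD(3)[OF base.ideal] two_sided_diff[OF ideal_J], assumption)+
  then show ?thesis by (simp add: gt_eq[OF n4(1)])
qed

lemma gives_min_res_gt: "gives_min_res S J gt"
proof -
  have high: "finite (gt n) \<and> (\<forall>x\<in>gt n. uniform S x \<and> x \<noteq> pzero
      \<and> (\<exists>!r. decomp_in S (gt (n - 1)) UNIV x r) \<and> (\<exists>!s. decomp_in S (gt (n - 2)) J x s))"
    if n: "3 \<le> n" for n
  proof -
    have n': "2 \<le> n" "1 \<le> n" using n by auto
    show ?thesis
      unfolding gt_eq[OF n'(1)]
    proof (intro conjI ballI)
      fix x assume "x \<in> th ` g n"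
      then obtain z where z: "z \<in> g n" "x = th z" by blast
      show "uniform S x" "x \<noteq> pzero"
        using gD(2,3)[OF n'(2) z(1)] by (auto simp: z uniform_th pzero_eq_zero)
      show "\<exists>!r. decomp_in S (gt (n - 1)) UNIV x r"
        unfolding z(2) decomp_gt_iff[OF n z(1)] by simp
      show "\<exists>!s. decomp_in S (gt (n - 2)) J x s"
        unfolding z(2) by (rule ex1_decomp_J[OF n z(1)])
    qed (simp add: gD(1)[OF n'(2)])
  qed
  have exact: "(\<forall>z. dmap S gt n f z \<in> J) \<longleftrightarrow>
      (\<exists>h. inP S gt (Suc n) h \<and> (\<forall>x. psub (f x) (dmap S gt (Suc n) h x) \<in> J))"
    if "1 \<le> n" "inP S gt n f" for n f
  proof (cases "n = 1")
    case True
    then show ?thesis using stretched_exact1 that(2) by (simp add: numeral_2_eq_2 One_nat_def)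
  next
    case False
    then have "2 \<le> n" using that(1) by simp
    from exact_gt[OF this that(2)] show ?thesis by (simp add: psub_eq_minus)
  qed
  have minimal: "coef S gt n x z (v, []) = 0" if n: "1 \<le> n" and that: "x \<in> gt n" "z \<in> gt (n - 1)" for n x z v
  proof -
    consider "n = 1" | "n = 2" | "3 \<le> n" using n by linarith
    then show ?thesis
    proof cases
      case 1
      then show ?thesis using that stretched_minimal1 by simp
    next
      case 2
      then show ?thesis using that stretched_minimal2 by (simp flip: One_nat_def)
    next
      case 3
      then have "2 \<le> n" "2 \<le> n - 1" by auto
      then show ?thesis using that 3 minimal_gt by (auto simp: gt_eq)
    qed
  qed
  show ?thesis
    unfolding gives_min_res_def
  proof (intro conjI)
    show "\<forall>n\<ge>3. finite (gt n) \<and> (\<forall>x\<in>gt n. uniform S x \<and> x \<noteq> pzero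
        \<and> (\<exists>!r. decomp_in S (gt (n - 1)) UNIV x r) \<and> (\<exists>!s. decomp_in S (gt (n - 2)) J x s))"
      using high by simp
    show "\<forall>c. \<exists>f. inP S gt 0 f \<and> (\<forall>v\<in>verts S. dzero f v = c v)"
      using stretched_dzero_surj by simp
    show "\<forall>f. inP S gt 0 f \<longrightarrow> ((\<forall>v\<in>verts S. dzero f v = 0) \<longleftrightarrow>
        (\<exists>h. inP S gt 1 h \<and> (\<forall>x. psub (f x) (dmap S gt 1 h x) \<in> J)))"
      using stretched_exact0 by simp
    show "\<forall>n\<ge>1. \<forall>f. inP S gt n f \<longrightarrow> ((\<forall>z. dmap S gt n f z \<in> J) \<longleftrightarrow>
        (\<exists>h. inP S gt (Suc n) h \<and> (\<forall>x. psub (f x) (dmap S gt (Suc n) h x) \<in> J)))"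
      using exact by simp
    show "\<forall>n\<ge>1. \<forall>x\<in>gt n. \<forall>z\<in>gt (n - 1). \<forall>v. coef S gt n x z (v, []) = 0"
      using minimal by simp
  qed (rule admissible_J stretched_g0 stretched_g1 min_gen_set_J)+
qed

end

theorem theorem3p1:
  fixes Q :: "('v, 'a) quiver" and I :: "('v, 'a, 'k::field) pa set"
    and g :: "nat \<Rightarrow> ('v, 'a, 'k) pa set" and A :: nat
  assumes "wf_quiver Q" and "finite (verts Q)" and "finite (arrs Q)"
    and "A \<ge> 1"
    and "gives_min_res Q I g"
  shows "gives_min_res (stretch Q A) (ideal_gen (stretch Q A) (thetastar A ` g 2)) (gtilde Q A g)
    \<and> (\<forall>n\<ge>3. \<forall>x\<in>g n. \<forall>z\<in>g (n - 1).
         coef (stretch Q A) (gtilde Q A g) n (thetastar A x) (thetastar A z)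
           = thetastar A (coef Q g n x z))"
proof -
  interpret stretched_resolution Q A I g
    using assms by unfold_locales
  have "thetastar A ` g 2 = th ` g 2" by (rule thetastar_image) simp
  moreover have "coef S gt n (thetastar A x) (thetastar A z) = thetastar A (coef Q g n x z)"
    if "3 \<le> n" "x \<in> g n" "z \<in> g (n - 1)" for n x z
  proof -
    have "2 \<le> n" "1 \<le> n" "1 \<le> n - 1" using that(1) by auto
    \<comment> \<open>\<open>thetastar\<close> is replaced by \<open>th\<close> on finitely
      supported elements, so the coefficient has to be known to lie in KQ as well.\<close>
    then have "in_KQ Q x" "in_KQ Q z" "in_KQ Q (coef Q g n x z)"
      using that(2,3) gD(4) coef_props(1) by blast+
    then show ?thesis
      using that by (simp add: thetastar_eq_th in_KQ_finite coef_gt)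
  qed
  ultimately show ?thesis using gives_min_res_gt by simp
qed

end
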